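(* For integers $m,n\ge 1$ and $d\ge 0$, let $h(m,n,d)$ be the number of $m\times n$ Cauchon diagrams whose toric permutation has exactly $d$ odd cycles, where an odd cycle is a cycle of even length in the disjoint cycle decomposition. Then for all $m,n\ge1$ and $d\ge0$, $h(m,n,d)$ equals the coefficient of $t^d\frac{x^m}{m!}\frac{y^n}{n!}$ in the power series expansion of $$C(x,y,t)=(e^{-y}+e^{-x}-1)^{\frac{-1-t}{2}}(e^x+e^y-1)^{\frac{1-t}{2}}.$$
   Context: An $m\times n$ diagram is an $m\times n$ grid of squares, each coloured black or white. Rows are numbered top to bottom and columns left to right. It is a Cauchon diagram if for every black square, either all squares strictly above it in its column are black or all squares strictly to its left in its row are black. Pipe dreams: on each white square place two arcs, one joining its bottom and left edge midpoints and one joining its top and right edge midpoints. On each black square place a cross, i.e. a vertical segment joining its bottom and top midpoints and a horizontal segment joining its left and right midpoints. Label the boundary as follows: the row that is $r$-th from the bottom gets label $r$ at its left end and $n+r$ at its right end; column $j$ gets label $m+j$ at its top and $j$ at its bottom. The restricted permutation $\sigma\in S_{m+n}$ of $D$ sends a label $i$ on the bottom or right side to the label on the left or top side where the pipe entering at $i$ exits (going straight through crosses). The permutation $\omega$ is defined by $\omega(i)=m+i$ for $1\le i\le n$ and $\omega(i)=i-n$ for $n<i\le m+n$. The toric permutation of $D$ is $\tau=\sigma\omega^{-1}$. *)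

theory Defs
  imports "HOL-Analysis.Analysis"
begin

text \<open>An m x n diagram is represented by its set B of black squares (i,j),
  with rows 1..m (top to bottom) and columns 1..n (left to right).\<close>

definition is_diagram :: "nat \<Rightarrow> nat \<Rightarrow> (nat \<times> nat) set \<Rightarrow> bool" where
  "is_diagram m n B \<longleftrightarrow> B \<subseteq> {1..m} \<times> {1..n}"

definition cauchon :: "nat \<Rightarrow> nat \<Rightarrow> (nat \<times> nat) set \<Rightarrow> bool" where
  "cauchon m n B \<longleftrightarrow> is_diagram m n B \<and>
     (\<forall>(i,j)\<in>B. (\<forall>i'. 1 \<le> i' \<and> i' < i \<longrightarrow> (i',j) \<in> B) \<or>
                  (\<forall>j'. 1 \<le> j' \<and> j' < j \<longrightarrow> (i,j') \<in> B))"

text \<open>Pipe tracing. trace B m up i j: the pipe currently occupies square (i,j),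
  having entered it from the bottom (up = True, moving upward) or from the right
  (up = False, moving leftward). Result: the label on the left/top boundary where it exits.
  White squares: bottom<->left and top<->right arcs; black squares: crosses.
  Row i (from top) is row m+1-i from the bottom: left label m+1-i; column j has top label m+j.\<close>

function trace :: "(nat \<times> nat) set \<Rightarrow> nat \<Rightarrow> bool \<Rightarrow> nat \<Rightarrow> nat \<Rightarrow> nat" where
  "trace B m up i j =
     (if up then
        (if (i,j) \<in> B then (if i \<le> 1 then m + j else trace B m True (i - 1) j)
         else (if j \<le> 1 then m + 1 - i else trace B m False i (j - 1)))
      else
        (if (i,j) \<in> B then (if j \<le> 1 then m + 1 - i else trace B m False i (j - 1))
         else (if i \<le> 1 then m + j else trace B m True (i - 1) j)))"
  by pat_completeness auto
termination
  by (relation "Wellfounded.measure (\<lambda>(B,m,up,i,j). i + j)") auto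

text \<open>Restricted permutation sigma on {1..m+n} (identity outside). Bottom label j (1<=j<=n)
  enters square (m,j) from below; right label n+r (1<=r<=m) enters square (m+1-r, n) from the right.\<close>

definition restricted_perm :: "nat \<Rightarrow> nat \<Rightarrow> (nat \<times> nat) set \<Rightarrow> nat \<Rightarrow> nat" where
  "restricted_perm m n B k =
     (if 1 \<le> k \<and> k \<le> n then trace B m True m k
      else if n < k \<and> k \<le> n + m then trace B m False (m + 1 - (k - n)) n
      else k)"

definition omega :: "nat \<Rightarrow> nat \<Rightarrow> nat \<Rightarrow> nat" where
  "omega m n i = (if 1 \<le> i \<and> i \<le> n then m + i else if n < i \<and> i \<le> m + n then i - n else i)"

definition omega_inv :: "nat \<Rightarrow> nat \<Rightarrow> nat \<Rightarrow> nat" where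
  "omega_inv m n k = (if m < k \<and> k \<le> m + n then k - m else if 1 \<le> k \<and> k \<le> m then k + n else k)"

definition toric_perm :: "nat \<Rightarrow> nat \<Rightarrow> (nat \<times> nat) set \<Rightarrow> nat \<Rightarrow> nat" where
  "toric_perm m n B = restricted_perm m n B \<circ> omega_inv m n"

definition cycle_of :: "(nat \<Rightarrow> nat) \<Rightarrow> nat \<Rightarrow> nat set" where
  "cycle_of f x = {(f ^^ k) x | k. True}"

definition num_odd_cycles :: "nat \<Rightarrow> (nat \<Rightarrow> nat) \<Rightarrow> nat" where
  "num_odd_cycles N f = card {cycle_of f x | x. x \<in> {1..N} \<and> even (card (cycle_of f x))}"

definition h :: "nat \<Rightarrow> nat \<Rightarrow> nat \<Rightarrow> nat" where
  "h m n d = card {B. cauchon m n B \<and> num_odd_cycles (m + n) (toric_perm m n B) = d}"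

definition genC :: "real \<Rightarrow> real \<Rightarrow> real \<Rightarrow> real" where
  "genC x y t = (exp (-y) + exp (-x) - 1) powr ((-1 - t) / 2) * (exp x + exp y - 1) powr ((1 - t) / 2)"

text \<open>Coefficient of t^d x^m/m! y^n/n! in the (real-analytic near 0) function genC:
  d_x^m d_y^n (d_t^d genC(x,y,0) / d!) at (0,0).\<close>

definition coeffC :: "nat \<Rightarrow> nat \<Rightarrow> nat \<Rightarrow> real" where
  "coeffC m n d = (deriv ^^ m) (\<lambda>x. (deriv ^^ n) (\<lambda>y. (deriv ^^ d) (\<lambda>t. genC x y t) 0 / fact d) 0) 0"

end

theory Submission
  imports Defs "HOL-Combinatorics.Cycles" "HOL-Combinatorics.Orbits"
begin

text \<open>
  Reading the squares row by row, each white square multiplies the toric permutation by a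
  transposition, and a black square is allowed exactly when its row label or its column label is still
  a fixed point. Undoing these steps shows that the toric permutations of Cauchon diagrams are
  precisely the permutations \<open>p\<close> of \<open>{1..m+n}\<close> with \<open>p k \<ge> k\<close> for \<open>k \<le> m\<close> and \<open>p k \<le> k\<close> for \<open>k > m\<close>,
  each occurring once.

  This condition concerns every cycle separately. Starting from its largest element, a cycle that is
  not a fixed point alternates between decreasing runs in \<open>{m+1..m+n}\<close> and increasing runs in
  \<open>{1..m}\<close>, so the exponential generating function of the cycles is
  \<open>L(x,y) = x + y - ln (1 - (exp x - 1) * (exp y - 1)) = - ln (exp (- x) + exp (- y) - 1)\<close>.
  Weighting the part of \<open>L\<close> that is even in \<open>(x,y)\<close> by \<open>t\<close> and exponentiating gives \<open>C\<close>. The argument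
  compares the two sides through \<open>\<partial>C/\<partial>y = C * \<partial>(ln C)/\<partial>y\<close>, which on the combinatorial side
  splits off the cycle through the largest element.
\<close>

section \<open>Toric permutations of Cauchon diagrams\<close>

definition toric_perms :: "nat set \<Rightarrow> nat set \<Rightarrow> (nat \<Rightarrow> nat) set" where
  "toric_perms A B = {p. p permutes (A \<union> B) \<and> (\<forall>a\<in>A. a \<le> p a) \<and> (\<forall>b\<in>B. p b \<le> b)}"

text \<open>
  The permutations that occur while the row with left label \<open>k\<close> is being read from left to right,
  once the columns with top labels up to \<open>c\<close> are done.
\<close>

definition row_perms :: "nat \<Rightarrow> nat set \<Rightarrow> nat set \<Rightarrow> nat \<Rightarrow> (nat \<Rightarrow> nat) set" where
  "row_perms k A B c = {q \<in> toric_perms (insert k A) B. q k \<le> c \<and> (\<forall>b\<in>B. c < b \<longrightarrow> q b \<noteq> k)}"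

text \<open>Composing with \<open>t\<close> exchanges the values at \<open>k\<close> and
  \<open>Suc c\<close>. In stage \<open>c\<close> one has \<open>q k \<le> c\<close> and
  \<open>q (Suc c) \<noteq> k\<close>, so a white square leaves neither label fixed, while a black
  one needs a fixed label; this makes the union disjoint. If neither label is fixed, exchanging back
  leads into stage \<open>c\<close>.\<close>

lemma row_perms_Suc:
  assumes k: "\<And>a. a \<in> A \<Longrightarrow> k < a" "\<And>b. b \<in> B \<Longrightarrow> k < b" and AB: "A \<inter> B = {}" and c: "Suc c \<in> B"
  defines "t \<equiv> Transposition.transpose k (Suc c)"
  shows "row_perms k A B (Suc c) = (\<lambda>q. q \<circ> t) ` row_perms k A B c \<union>
      {q \<in> row_perms k A B c. q k = k \<or> q (Suc c) = Suc c}" (is "?L = ?W \<union> ?K")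
    and "(\<lambda>q. q \<circ> t) ` row_perms k A B c \<inter> {q \<in> row_perms k A B c. q k = k \<or> q (Suc c) = Suc c} = {}"
proof -
  have kc: "k \<le> c" "k \<notin> A" "k \<notin> B" "Suc c \<notin> A" using k c AB by fastforce+
  have t: "t k = Suc c" "t (Suc c) = k" "\<And>x. x \<noteq> k \<Longrightarrow> x \<noteq> Suc c \<Longrightarrow> t x = x" "t \<circ> t = id"
    by (auto simp: t_def)
  have tp: "t permutes (insert k A \<union> B)"
    unfolding t_def by (rule permutes_swap_id) (use c in auto)
  \<comment> \<open>As \<open>k\<close> is the least label, the bound at \<open>k\<close> survives
    any exchange of values.\<close>
  have min: "k \<le> x" if "x \<in> insert k A \<union> B" for x using k that by fastforce
  have sub1: "?W \<subseteq> ?L"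
  proof safe
    fix q assume q: "q \<in> row_perms k A B c"
    then have qp: "q permutes (insert k A \<union> B)" by (auto simp: row_perms_def toric_perms_def)
    have "(q \<circ> t) permutes (insert k A \<union> B)" using tp qp by (rule permutes_compose)
    moreover have "a \<le> (q \<circ> t) a" if "a \<in> insert k A" for a
    proof (cases "a = k")
      case True
      have "q (Suc c) \<in> insert k A \<union> B" using permutes_in_image[OF qp] c by blast
      then show ?thesis using min t True by auto
    next
      case False
      then have "a \<noteq> Suc c" using that kc by auto
      then show ?thesis using False that q t by (auto simp: row_perms_def toric_perms_def)
    qed
    moreover have "(q \<circ> t) b \<le> b" if "b \<in> B" for b
    proof (cases "b = Suc c")
      case True
      then show ?thesis using q t by (auto simp: row_perms_def)
    next
      case False
      then have "b \<noteq> k" using that kc by auto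
      then show ?thesis using False that q t by (auto simp: row_perms_def toric_perms_def)
    qed
    moreover have "(q \<circ> t) k \<le> Suc c" using q t c by (auto simp: row_perms_def toric_perms_def)
    moreover have "(q \<circ> t) b \<noteq> k" if "b \<in> B" "Suc c < b" for b
    proof -
      have "b \<noteq> k" "b \<noteq> Suc c" using that kc by auto
      then show ?thesis using that q t by (auto simp: row_perms_def)
    qed
    ultimately show "q \<circ> t \<in> ?L" by (auto simp: row_perms_def toric_perms_def)
  qed
  have sub2: "?K \<subseteq> ?L" by (auto simp: row_perms_def)
  have sub3: "?L \<subseteq> ?W \<union> ?K"
  proof
    fix q assume q: "q \<in> ?L"
    then have qp: "q permutes (insert k A \<union> B)" by (auto simp: row_perms_def toric_perms_def)
    have inj: "q x = q y \<Longrightarrow> x = y" for x y using permutes_inj[OF qp] by (auto dest: injD)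
    show "q \<in> ?W \<union> ?K"
    proof (cases "q k = k \<or> q (Suc c) = Suc c")
      case True
      \<comment> \<open>Stage \<open>Suc c\<close> exceeds stage \<open>c\<close> only by allowing
        \<open>q k = Suc c\<close> and \<open>q (Suc c) = k\<close>. Injectivity excludes both once
        one of the labels is fixed.\<close>
      have "q k \<noteq> Suc c" using True inj[of k "Suc c"] kc by auto
      then have "q k \<le> c" using q by (auto simp: row_perms_def)
      moreover have "q (Suc c) \<noteq> k" using True inj[of k "Suc c"] kc by auto
      ultimately have "q \<in> row_perms k A B c"
        using q unfolding row_perms_def
        by (auto simp: less_Suc_eq_le) (metis Suc_lessI)
      then show ?thesis using True by auto
    next
      case False
      define p where "p = q \<circ> t"
      have qeq: "q = p \<circ> t" unfolding p_def by (simp add: comp_assoc t)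
      have "p permutes (insert k A \<union> B)" unfolding p_def using tp qp by (rule permutes_compose)
      moreover have "a \<le> p a" if "a \<in> insert k A" for a
      proof (cases "a = k")
        case True
        have "q (Suc c) \<in> insert k A \<union> B" using permutes_in_image[OF qp] c by blast
        then show ?thesis using min t True by (auto simp: p_def)
      next
        case False
        then have "a \<noteq> Suc c" using that kc by auto
        then show ?thesis using False that q t by (auto simp: row_perms_def toric_perms_def p_def)
      qed
      moreover have "p b \<le> b" if "b \<in> B" for b
      proof (cases "b = Suc c")
        case True
        then show ?thesis using q t by (auto simp: row_perms_def p_def)
      next
        case False
        then have "b \<noteq> k" using that kc by auto
        then show ?thesis using False that q t by (auto simp: row_perms_def toric_perms_def p_def)
      qed
      moreover have "p k \<le> c"
      proof -
        have "q (Suc c) \<le> Suc c" using q c by (auto simp: row_perms_def toric_perms_def)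
        then show ?thesis using False t by (auto simp: p_def)
      qed
      moreover have "p b \<noteq> k" if "b \<in> B" "c < b" for b
      proof (cases "b = Suc c")
        case True
        then show ?thesis using False t by (auto simp: p_def)
      next
        case False
        then have "b \<noteq> k" "Suc c < b" using that kc by auto
        then show ?thesis using that q t by (auto simp: row_perms_def p_def)
      qed
      ultimately have "p \<in> row_perms k A B c" by (auto simp: row_perms_def toric_perms_def)
      then show ?thesis using qeq by auto
    qed
  qed
  show "?L = ?W \<union> ?K" using sub1 sub2 sub3 by blast
  have "(q \<circ> t) k \<noteq> k" "(q \<circ> t) (Suc c) \<noteq> Suc c" if "q \<in> row_perms k A B c" for q
    using that c t by (auto simp: row_perms_def)
  then show "?W \<inter> ?K = {}" by blast
qed

text \<open>The preimage of \<open>k\<close> is not in \<open>B\<close>, as all of \<open>B\<close>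
  exceeds \<open>c\<close>, and not in \<open>A\<close>, where \<open>q a \<ge> a > k\<close>. So
  \<open>k\<close> is fixed and drops out of the support.\<close>

lemma row_perms_start:
  assumes k: "\<And>a. a \<in> A \<Longrightarrow> k < a" "\<And>b. b \<in> B \<Longrightarrow> k < b"
    and c: "k \<le> c" "\<And>b. b \<in> B \<Longrightarrow> c < b"
  shows "row_perms k A B c = toric_perms A B"
proof (intro set_eqI iffI)
  fix q assume q: "q \<in> row_perms k A B c"
  then have qp: "q permutes (insert k A \<union> B)" by (auto simp: row_perms_def toric_perms_def)
  obtain x where x: "q x = k" using permutes_surj[OF qp] by (metis surjD)
  then have "x \<in> insert k A \<union> B" using permutes_in_image[OF qp, of x] by auto
  moreover have "x \<notin> B" using q x c by (auto simp: row_perms_def)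
  moreover have "x \<notin> A" using q x k by (fastforce simp: row_perms_def toric_perms_def)
  ultimately have "q k = k" using x by auto
  then have "q permutes (A \<union> B)"
    using permutes_superset[OF qp, of "A \<union> B"] by auto
  then show "q \<in> toric_perms A B" using q by (auto simp: row_perms_def toric_perms_def)
next
  fix q assume q: "q \<in> toric_perms A B"
  then have qp: "q permutes (A \<union> B)" by (auto simp: toric_perms_def)
  have kn: "k \<notin> A \<union> B" using k by fastforce
  then have qk: "q k = k" using qp by (simp add: permutes_not_in)
  have "q permutes (insert k A \<union> B)" using qp by (rule permutes_subset) auto
  moreover have "q b \<noteq> k" if "b \<in> B" for b
    using permutes_in_image[OF qp, of b] kn that by auto
  ultimately show "q \<in> row_perms k A B c"
    using q qk c by (auto simp: row_perms_def toric_perms_def)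
qed

lemma row_perms_end:
  assumes "k \<le> c" "\<And>a. a \<in> A \<Longrightarrow> a \<le> c" "\<And>b. b \<in> B \<Longrightarrow> b \<le> c"
  shows "row_perms k A B c = toric_perms (insert k A) B"
proof -
  have "q k \<le> c" if "q \<in> toric_perms (insert k A) B" for q
  proof -
    have "q k \<in> insert k A \<union> B" using that permutes_in_image[of q "insert k A \<union> B" k] by (auto simp: toric_perms_def)
    then show ?thesis using assms by auto
  qed
  then show ?thesis using assms by (fastforce simp: row_perms_def)
qed

section \<open>Pipe tracing as a product of transpositions\<close>

definition up_exit :: "(nat \<times> nat) set \<Rightarrow> nat \<Rightarrow> nat \<Rightarrow> nat \<Rightarrow> nat" where
  "up_exit B m i j = (if i = 0 then m + j else trace B m True i j)"

text \<open>Like \<open>up_exit\<close>, this extends \<open>trace\<close> by boundary labels, to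
  column 0 here and to row 0 there, so that \<open>exit_Suc\<close> has no boundary cases.\<close>

definition left_exit :: "(nat \<times> nat) set \<Rightarrow> nat \<Rightarrow> nat \<Rightarrow> nat \<Rightarrow> nat" where
  "left_exit B m i j = (if j = 0 then m + 1 - i else trace B m False i j)"

declare trace.simps [simp del]

lemma exit_Suc:
  "up_exit B m (Suc i) (Suc j) =
     (if (Suc i, Suc j) \<in> B then up_exit B m i (Suc j) else left_exit B m (Suc i) j)"
  "left_exit B m (Suc i) (Suc j) =
     (if (Suc i, Suc j) \<in> B then left_exit B m (Suc i) j else up_exit B m i (Suc j))"
  using trace.simps[of B m True "Suc i" "Suc j"] trace.simps[of B m False "Suc i" "Suc j"]
  by (auto simp: up_exit_def left_exit_def)

text \<open>
  The state sends a column label to the exit of the pipe currently entering that column from below,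
  and a row label to the exit of the pipe entering that row from the right, so a white square
  exchanges the values at its row and its column, and a black square changes nothing.
\<close>

primrec row_state :: "nat \<Rightarrow> (nat \<times> nat) set \<Rightarrow> nat \<Rightarrow> (nat \<Rightarrow> nat) \<Rightarrow> nat \<Rightarrow> nat \<Rightarrow> nat" where
  "row_state m B i p 0 = p"
| "row_state m B i p (Suc j) = (if (i, Suc j) \<in> B then row_state m B i p j
     else row_state m B i p j \<circ> Transposition.transpose (m + 1 - i) (m + Suc j))"

primrec grid_state :: "nat \<Rightarrow> nat \<Rightarrow> (nat \<times> nat) set \<Rightarrow> nat \<Rightarrow> nat \<Rightarrow> nat" where
  "grid_state m n B 0 = id"
| "grid_state m n B (Suc i) = row_state m B (Suc i) (grid_state m n B i) n"

text \<open>By \<open>exit_Suc\<close> a white square swaps the two exits and a black one keeps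
  them, which is one step of \<open>row_state\<close>. Rows not yet reached keep their own
  label.\<close>

lemma grid_state_eq:
  assumes "i \<le> m"
  shows "grid_state m n B i = (\<lambda>x. if m < x \<and> x \<le> m + n then up_exit B m i (x - m)
      else if m + 1 - i \<le> x \<and> x \<le> m then left_exit B m (m + 1 - x) n else x)"
  using assms
proof (induction i)
  case 0
  show ?case by (auto simp: fun_eq_iff up_exit_def)
next
  case (Suc i)
  \<comment> \<open>In mid-row the label \<open>m - i\<close> holds the exit of the pipe entering
    column \<open>j\<close> from the right; at \<open>j = 0\<close> this is the left label
    \<open>m - i\<close> itself.\<close>
  have row: "row_state m B (Suc i) (grid_state m n B i) j =
     (\<lambda>x. if m < x \<and> x \<le> m + n then (if x - m \<le> j then up_exit B m (Suc i) (x - m) else up_exit B m i (x - m))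
      else if m + 1 - i \<le> x \<and> x \<le> m then left_exit B m (m + 1 - x) n
      else if x = m - i then left_exit B m (Suc i) j else x)" if "j \<le> n" for j
    using that
  proof (induction j)
    case 0
    show ?case using Suc by (auto simp: fun_eq_iff left_exit_def)
  next
    case (Suc j)
    have k: "m + 1 - Suc i = m - i" by simp
    have kn: "m - i \<le> m" "\<not> m + 1 - i \<le> m - i" using \<open>Suc i \<le> m\<close> by auto
    show ?case
    proof
      fix x
      consider "x = m - i" | "x = m + Suc j" | "x \<noteq> m - i" "x \<noteq> m + Suc j" by blast
      then show "row_state m B (Suc i) (grid_state m n B i) (Suc j) x =
         (if m < x \<and> x \<le> m + n then (if x - m \<le> Suc j then up_exit B m (Suc i) (x - m) else up_exit B m i (x - m))
          else if m + 1 - i \<le> x \<and> x \<le> m then left_exit B m (m + 1 - x) n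
          else if x = m - i then left_exit B m (Suc i) (Suc j) else x)"
      proof cases
        case 1
        then show ?thesis using Suc kn unfolding row_state.simps k by (auto simp: exit_Suc)
      next
        case 2
        then show ?thesis using Suc kn unfolding row_state.simps k by (auto simp: exit_Suc)
      next
        case 3
        then have "Transposition.transpose (m - i) (m + Suc j) x = x" by simp
        moreover have "x - m \<le> Suc j \<longleftrightarrow> x - m \<le> j" if "m < x" using 3 that by auto
        ultimately show ?thesis using Suc 3 unfolding row_state.simps k by auto
      qed
    qed
  qed
  show ?case
    unfolding grid_state.simps row[OF order.refl] fun_eq_iff
  proof
    fix x
    consider "m < x" | "x \<le> m" "m + 1 - i \<le> x" | "x = m - i" | "x < m - i" by linarith
    then show "(if m < x \<and> x \<le> m + n then (if x - m \<le> n then up_exit B m (Suc i) (x - m) else up_exit B m i (x - m))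
      else if m + 1 - i \<le> x \<and> x \<le> m then left_exit B m (m + 1 - x) n
      else if x = m - i then left_exit B m (Suc i) n else x) =
      (if m < x \<and> x \<le> m + n then up_exit B m (Suc i) (x - m)
      else if m + 1 - Suc i \<le> x \<and> x \<le> m then left_exit B m (m + 1 - x) n else x)"
    proof cases
      case 3
      then have "m + 1 - x = Suc i" "\<not> m < x" "\<not> m + 1 - i \<le> x" using \<open>Suc i \<le> m\<close> by auto
      then show ?thesis using 3 by simp
    qed auto
  qed
qed

text \<open>\<open>omega_inv\<close> sends the top label of a column to its bottom label and the
  left label of a row to its right label, so \<open>toric_perm\<close> follows the pipe entering
  that column or row.\<close>

lemma toric_perm_eq_grid_state:
  assumes "m \<ge> 1" "n \<ge> 1"
  shows "toric_perm m n B = grid_state m n B m"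
  unfolding grid_state_eq[OF order.refl] fun_eq_iff
proof
  fix x
  show "toric_perm m n B x = (if m < x \<and> x \<le> m + n then up_exit B m m (x - m)
      else if m + 1 - m \<le> x \<and> x \<le> m then left_exit B m (m + 1 - x) n else x)"
    using assms
    by (auto simp: toric_perm_def restricted_perm_def omega_inv_def up_exit_def left_exit_def)
qed

section \<open>Growing Cauchon diagrams one square at a time\<close>

definition cauchon_cond :: "(nat \<times> nat) set \<Rightarrow> bool" where
  "cauchon_cond B \<longleftrightarrow> (\<forall>(i,j)\<in>B. (\<forall>i'. 1 \<le> i' \<and> i' < i \<longrightarrow> (i',j) \<in> B) \<or>
                  (\<forall>j'. 1 \<le> j' \<and> j' < j \<longrightarrow> (i,j') \<in> B))"

definition partial_diagrams :: "nat \<Rightarrow> nat \<Rightarrow> nat \<Rightarrow> (nat \<times> nat) set set" where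
  "partial_diagrams n i j = {B. B \<subseteq> {1..i} \<times> {1..n} \<union> {Suc i} \<times> {1..j} \<and> cauchon_cond B}"

text \<open>The condition at a black square looks only upward and to the left. The new square comes
  last in reading order, so adding or removing it does not affect the earlier ones.\<close>

lemma partial_diagrams_Suc:
  assumes "j < n"
  shows "partial_diagrams n i (Suc j) = partial_diagrams n i j \<union>
     insert (Suc i, Suc j) ` {B \<in> partial_diagrams n i j.
       (\<forall>j'\<in>{1..j}. (Suc i, j') \<in> B) \<or> (\<forall>i'\<in>{1..i}. (i', Suc j) \<in> B)}" (is "?L = ?R \<union> ?S")
proof -
  let ?c = "(Suc i, Suc j)"
  have sub: "{1..i} \<times> {1..n} \<union> {Suc i} \<times> {1..j} \<subseteq> {1..i} \<times> {1..n} \<union> {Suc i} \<times> {1..Suc j}"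
    by auto
  have new: "?c \<notin> B" if "B \<in> partial_diagrams n i j" for B
    using that by (auto simp: partial_diagrams_def)
  have "B \<in> ?R \<union> ?S" if B: "B \<in> ?L" for B
  proof (cases "?c \<in> B")
    case False
    have "B \<subseteq> {1..i} \<times> {1..n} \<union> {Suc i} \<times> {1..j}"
    proof
      fix z assume z: "z \<in> B"
      then have "z \<in> {1..i} \<times> {1..n} \<union> {Suc i} \<times> {1..Suc j}" "z \<noteq> ?c"
        using B False by (auto simp: partial_diagrams_def)
      then show "z \<in> {1..i} \<times> {1..n} \<union> {Suc i} \<times> {1..j}" by (cases z) (auto simp: le_Suc_eq)
    qed
    then show ?thesis using B by (auto simp: partial_diagrams_def)
  next
    case True
    define B' where "B' = B - {?c}"
    have BB: "B = insert ?c B'" using True by (auto simp: B'_def)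
    have "B' \<subseteq> {1..i} \<times> {1..n} \<union> {Suc i} \<times> {1..j}"
    proof
      fix z assume z: "z \<in> B'"
      then have "z \<in> {1..i} \<times> {1..n} \<union> {Suc i} \<times> {1..Suc j}" "z \<noteq> ?c"
        using B by (auto simp: partial_diagrams_def B'_def)
      then show "z \<in> {1..i} \<times> {1..n} \<union> {Suc i} \<times> {1..j}" by (cases z) (auto simp: le_Suc_eq)
    qed
    moreover from this have "cauchon_cond B'"
      using B unfolding cauchon_cond_def partial_diagrams_def B'_def by fastforce
    moreover have "(\<forall>i'. 1 \<le> i' \<and> i' < Suc i \<longrightarrow> (i', Suc j) \<in> B) \<or> (\<forall>j'. 1 \<le> j' \<and> j' < Suc j \<longrightarrow> (Suc i, j') \<in> B)"
      using B True unfolding cauchon_cond_def partial_diagrams_def by blast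
    then have "(\<forall>j'\<in>{1..j}. (Suc i, j') \<in> B') \<or> (\<forall>i'\<in>{1..i}. (i', Suc j) \<in> B')"
      unfolding B'_def by auto
    ultimately show ?thesis using BB by (auto simp: partial_diagrams_def)
  qed
  moreover have "B \<in> ?L" if "B \<in> ?R" for B
    using that sub unfolding partial_diagrams_def by blast
  moreover have "B \<in> ?L" if "B \<in> ?S" for B
  proof -
    from that obtain B' where B1: "B = insert ?c B'" and B2: "B' \<in> {B \<in> partial_diagrams n i j.
       (\<forall>j'\<in>{1..j}. (Suc i, j') \<in> B) \<or> (\<forall>i'\<in>{1..i}. (i', Suc j) \<in> B)}" by (rule imageE)
    then have B': "B = insert ?c B'" "B' \<in> partial_diagrams n i j"
      "(\<forall>j'\<in>{1..j}. (Suc i, j') \<in> B') \<or> (\<forall>i'\<in>{1..i}. (i', Suc j) \<in> B')" by simp_all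
    have "(\<forall>i'. 1 \<le> i' \<and> i' < a \<longrightarrow> (i', b) \<in> B) \<or> (\<forall>j'. 1 \<le> j' \<and> j' < b \<longrightarrow> (a, j') \<in> B)"
      if "(a, b) \<in> B" for a b
    proof (cases "(a, b) = ?c")
      case True
      then show ?thesis using B'(1,3) by auto
    next
      case False
      then have "(a, b) \<in> B'" using that B'(1) by auto
      then have "(\<forall>i'. 1 \<le> i' \<and> i' < a \<longrightarrow> (i', b) \<in> B') \<or> (\<forall>j'. 1 \<le> j' \<and> j' < b \<longrightarrow> (a, j') \<in> B')"
        using B'(2) unfolding partial_diagrams_def cauchon_cond_def by blast
      then show ?thesis using B'(1) by blast
    qed
    then have "cauchon_cond B" unfolding cauchon_cond_def by blast
    moreover have "B \<subseteq> {1..i} \<times> {1..n} \<union> {Suc i} \<times> {1..Suc j}"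
      using B'(1,2) sub unfolding partial_diagrams_def by auto
    ultimately show ?thesis by (auto simp: partial_diagrams_def)
  qed
  ultimately show ?thesis by blast
qed

lemma row_state_cong:
  assumes "\<And>j'. j' \<le> j \<Longrightarrow> (i, j') \<in> B \<longleftrightarrow> (i, j') \<in> B'"
  shows "row_state m B i p j = row_state m B' i p j"
  using assms by (induction j) auto

lemma grid_state_cong:
  assumes "\<And>i' j'. i' \<le> i \<Longrightarrow> (i', j') \<in> B \<longleftrightarrow> (i', j') \<in> B'"
  shows "grid_state m n B i = grid_state m n B' i"
  using assms
proof (induction i)
  case (Suc i)
  then have "grid_state m n B i = grid_state m n B' i" by simp
  then show ?case using row_state_cong[of n "Suc i" B B'] Suc.prems by simp
qed simp


text \<open>Whether the next square may be black can be read off from the fixed points of the state.\<close>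

definition row_inv :: "nat \<Rightarrow> nat \<Rightarrow> nat \<Rightarrow> nat \<Rightarrow> (nat \<times> nat) set \<Rightarrow> (nat \<Rightarrow> nat) \<Rightarrow> bool" where
  "row_inv m n i j B q \<longleftrightarrow> (q (m - i) = m - i \<longleftrightarrow> (\<forall>j'\<in>{1..j}. (Suc i, j') \<in> B)) \<and>
     (\<forall>c\<in>{1..n}. q (m + c) = m + c \<longleftrightarrow> (\<forall>i'\<in>{1..(if c \<le> j then Suc i else i)}. (i', c) \<in> B))"

lemma row_inv_column:
  "row_inv m n i j B q \<Longrightarrow> c \<in> {1..n} \<Longrightarrow>
     q (m + c) = m + c \<longleftrightarrow> (\<forall>i'\<in>{1..(if c \<le> j then Suc i else i)}. (i', c) \<in> B)"
  unfolding row_inv_def by blast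

text \<open>\<open>row_inv\<close> turns the Cauchon condition at the next square into one of its
  two labels being fixed. The white and black continuations then match the two disjoint pieces in
  \<open>row_perms_Suc\<close>.\<close>

lemma row_bij:
  assumes i: "i < m"
    and bij: "bij_betw (\<lambda>B. grid_state m n B i) (partial_diagrams n i 0) (toric_perms {m + 1 - i..m} {m + 1..m + n})"
    and col: "\<And>B c. B \<in> partial_diagrams n i 0 \<Longrightarrow> c \<in> {1..n} \<Longrightarrow>
        grid_state m n B i (m + c) = m + c \<longleftrightarrow> (\<forall>i'\<in>{1..i}. (i', c) \<in> B)"
    and j: "j \<le> n"
  shows "bij_betw (\<lambda>B. row_state m B (Suc i) (grid_state m n B i) j) (partial_diagrams n i j)
        (row_perms (m - i) {m + 1 - i..m} {m + 1..m + n} (m + j)) \<and>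
     (\<forall>B\<in>partial_diagrams n i j. row_inv m n i j B (row_state m B (Suc i) (grid_state m n B i) j))"
  using j
proof (induction j)
  case 0
  let ?k = "m - i" and ?A = "{m + 1 - i..m}" and ?B = "{m + 1..m + n}"
  have "row_perms ?k ?A ?B m = toric_perms ?A ?B"
    by (rule row_perms_start) (use i in auto)
  moreover have "row_inv m n i 0 B (grid_state m n B i)" if B: "B \<in> partial_diagrams n i 0" for B
  proof -
    have "grid_state m n B i permutes (?A \<union> ?B)"
      using bij_betwE[OF bij] B by (auto simp: toric_perms_def)
    then have "grid_state m n B i ?k = ?k" by (rule permutes_not_in) (use i in auto)
    then show ?thesis using col[OF B] by (auto simp: row_inv_def)
  qed
  ultimately show ?case using bij by simp
next
  case (Suc j)
  let ?k = "m - i" and ?A = "{m + 1 - i..m}" and ?B = "{m + 1..m + n}" and ?c = "(Suc i, Suc j)"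
  let ?D = "partial_diagrams n i j" and ?Z = "row_perms (m - i) {m + 1 - i..m} {m + 1..m + n} (m + j)"
  define t where "t = Transposition.transpose ?k (Suc (m + j))"
  define st where "st = (\<lambda>B. row_state m B (Suc i) (grid_state m n B i) j)"
  define st' where "st' = (\<lambda>B. row_state m B (Suc i) (grid_state m n B i) (Suc j))"
  have IH: "bij_betw st ?D ?Z" "\<And>B. B \<in> ?D \<Longrightarrow> row_inv m n i j B (st B)"
    using Suc unfolding st_def by auto
  have jn: "j < n" using Suc by auto
  have tt: "t ?k = Suc (m + j)" "t (Suc (m + j)) = ?k" "t \<circ> t = id" by (auto simp: t_def)
  have t3: "x \<noteq> ?k \<Longrightarrow> x \<noteq> Suc (m + j) \<Longrightarrow> t x = x" for x by (auto simp: t_def)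
  have notin: "?c \<notin> B" if "B \<in> ?D" for B using that by (auto simp: partial_diagrams_def)
  have white: "st' B = st B \<circ> t" if "B \<in> ?D" for B
    using notin[OF that] i by (simp add: st'_def st_def t_def)
  have black: "st' (insert ?c B) = st B" for B
  proof -
    have "grid_state m n (insert ?c B) i = grid_state m n B i" by (rule grid_state_cong) auto
    moreover have "row_state m (insert ?c B) (Suc i) p j = row_state m B (Suc i) p j" for p
      by (rule row_state_cong) auto
    ultimately show ?thesis by (simp add: st'_def st_def)
  qed
  \<comment> \<open>The diagrams in which the next square may be black.\<close>
  define K where "K = {B \<in> ?D. (\<forall>j'\<in>{1..j}. (Suc i, j') \<in> B) \<or> (\<forall>i'\<in>{1..i}. (i', Suc j) \<in> B)}"
  have KD: "K \<subseteq> ?D" unfolding K_def by (rule Collect_restrict)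
  have D: "partial_diagrams n i (Suc j) = ?D \<union> insert ?c ` K"
    unfolding K_def by (rule partial_diagrams_Suc[OF jn])
  have K: "K = {B \<in> ?D. st B ?k = ?k \<or> st B (Suc (m + j)) = Suc (m + j)}"
    unfolding K_def
  proof (intro Collect_cong conj_cong refl)
    fix B assume "B \<in> ?D"
    then have r: "row_inv m n i j B (st B)" by (rule IH(2))
    from row_inv_column[OF this, of "Suc j"] have "st B (m + Suc j) = m + Suc j \<longleftrightarrow> (\<forall>i'\<in>{1..i}. (i', Suc j) \<in> B)"
      using jn by simp
    with r show "((\<forall>j'\<in>{1..j}. (Suc i, j') \<in> B) \<or> (\<forall>i'\<in>{1..i}. (i', Suc j) \<in> B)) =
       (st B ?k = ?k \<or> st B (Suc (m + j)) = Suc (m + j))"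
      unfolding row_inv_def by simp
  qed
  have pre: "\<And>a. a \<in> ?A \<Longrightarrow> ?k < a" "\<And>b. b \<in> ?B \<Longrightarrow> ?k < b" "?A \<inter> ?B = {}" "Suc (m + j) \<in> ?B"
    using i jn by auto
  have Z: "row_perms ?k ?A ?B (m + Suc j) = (\<lambda>q. q \<circ> t) ` ?Z \<union> {q \<in> ?Z. q ?k = ?k \<or> q (Suc (m + j)) = Suc (m + j)}"
    and disj: "(\<lambda>q. q \<circ> t) ` ?Z \<inter> {q \<in> ?Z. q ?k = ?k \<or> q (Suc (m + j)) = Suc (m + j)} = {}"
    using row_perms_Suc[OF pre] unfolding t_def add_Suc_right by blast+
  have b1: "bij_betw st' ?D ((\<lambda>q. q \<circ> t) ` ?Z)"
  proof -
    have "inj_on (\<lambda>q. q \<circ> t) ?Z"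
      by (rule inj_on_inverseI[where g = "\<lambda>q. q \<circ> t"]) (simp add: comp_assoc tt)
    then have "bij_betw (\<lambda>q. q \<circ> t) ?Z ((\<lambda>q. q \<circ> t) ` ?Z)" by (rule inj_on_imp_bij_betw)
    from bij_betw_trans[OF IH(1) this] have "bij_betw ((\<lambda>q. q \<circ> t) \<circ> st) ?D ((\<lambda>q. q \<circ> t) ` ?Z)" .
    moreover have "bij_betw st' ?D X = bij_betw ((\<lambda>q. q \<circ> t) \<circ> st) ?D X" for X
      by (rule bij_betw_cong) (simp add: white)
    ultimately show ?thesis by blast
  qed
  have b2: "bij_betw st' (insert ?c ` K) {q \<in> ?Z. q ?k = ?k \<or> q (Suc (m + j)) = Suc (m + j)}"
  proof -
    have "bij_betw st K (st ` K)" using IH(1) K by (auto simp: bij_betw_def intro: inj_on_subset)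
    moreover have "st ` K = {q \<in> ?Z. q ?k = ?k \<or> q (Suc (m + j)) = Suc (m + j)}"
      unfolding K using bij_betw_imp_surj_on[OF IH(1)] by auto
    ultimately have bK: "bij_betw st K {q \<in> ?Z. q ?k = ?k \<or> q (Suc (m + j)) = Suc (m + j)}" by simp
    have "inj_on st' (insert ?c ` K)"
    proof (rule inj_onI)
      fix X Y assume "X \<in> insert ?c ` K" "Y \<in> insert ?c ` K" and e: "st' X = st' Y"
      then obtain X' Y' where "X = insert ?c X'" "Y = insert ?c Y'" "X' \<in> K" "Y' \<in> K" by blast
      with e bK black show "X = Y" by (auto simp: bij_betw_def dest: inj_onD)
    qed
    moreover have "st' ` insert ?c ` K = st ` K" by (simp add: image_image black)
    ultimately show ?thesis using bK by (simp add: bij_betw_def)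
  qed
  have inv: "row_inv m n i (Suc j) B (st' B)" if "B \<in> partial_diagrams n i (Suc j)" for B
  proof -
    have "B \<in> ?D \<union> insert ?c ` K" using that unfolding D .
    then consider "B \<in> ?D" | B' where "B = insert ?c B'" "B' \<in> ?D"
    proof (elim UnE imageE)
      fix B' assume "B = insert ?c B'" "B' \<in> K"
      with that(2) KD show thesis by blast
    qed
    then show ?thesis
    proof cases
      case 1
      \<comment> \<open>A white square unfixes both of its labels, just as it breaks the black
        stretch in its row and in its column.\<close>
      have "st B \<in> ?Z" using IH(1) 1 by (rule bij_betwE[THEN bspec])
      then have z: "st B ?k \<le> m + j" "st B (Suc (m + j)) \<noteq> ?k" using jn by (auto simp: row_perms_def)
      have "st' B (m + c) = m + c \<longleftrightarrow> (\<forall>i'\<in>{1..(if c \<le> Suc j then Suc i else i)}. (i', c) \<in> B)" if "c \<in> {1..n}" for c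
      proof (cases "c = Suc j")
        case True
        have "\<not> (\<forall>i'\<in>{1..Suc i}. (i', c) \<in> B)" using notin[OF 1] True by auto
        moreover have "st' B (m + c) \<noteq> m + c" using z True by (simp add: white[OF 1] tt)
        ultimately show ?thesis using True by auto
      next
        case False
        then have "t (m + c) = m + c" using that by (intro t3) auto
        then have "st' B (m + c) = st B (m + c)" by (simp add: white[OF 1])
        moreover have "c \<le> Suc j \<longleftrightarrow> c \<le> j" using False by auto
        ultimately show ?thesis using row_inv_column[OF IH(2)[OF 1] that] by simp
      qed
      moreover have "st' B ?k \<noteq> ?k" using z by (simp add: white[OF 1] tt)
      moreover have "\<not> (\<forall>j'\<in>{1..Suc j}. (Suc i, j') \<in> B)" using notin[OF 1] by auto
      ultimately show ?thesis unfolding row_inv_def by blast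
    next
      case 2
      have R: "row_inv m n i j B' (st B')" by (rule IH(2)[OF 2(2)])
      have "st B' (m + c) = m + c \<longleftrightarrow> (\<forall>i'\<in>{1..(if c \<le> Suc j then Suc i else i)}. (i', c) \<in> B)" if "c \<in> {1..n}" for c
      proof (cases "c = Suc j")
        case True
        have "(\<forall>i'\<in>{1..Suc i}. (i', c) \<in> B) \<longleftrightarrow> (\<forall>i'\<in>{1..i}. (i', c) \<in> B')"
          using 2 True by (auto simp: atLeastAtMostSuc_conv)
        then show ?thesis using row_inv_column[OF R that] True by simp
      next
        case False
        then have "(i', c) \<in> B \<longleftrightarrow> (i', c) \<in> B'" for i' using 2 by auto
        moreover have "c \<le> Suc j \<longleftrightarrow> c \<le> j" using False by auto
        ultimately show ?thesis using row_inv_column[OF R that] by simp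
      qed
      moreover have "st B' ?k = ?k \<longleftrightarrow> (\<forall>j'\<in>{1..Suc j}. (Suc i, j') \<in> B)"
        using R 2 by (auto simp: row_inv_def atLeastAtMostSuc_conv)
      ultimately show ?thesis using black[of B'] 2(1) unfolding row_inv_def by simp
    qed
  qed
  from bij_betw_combine[OF b1 b2 disj] inv show ?case
    unfolding D Z st'_def by blast
qed

text \<open>A finished row adjoins its label \<open>m - i\<close>. The clause on columns is carried
  along because \<open>row_bij\<close> needs it at the start of each row.\<close>

lemma grid_bij:
  assumes "i \<le> m"
  shows "bij_betw (\<lambda>B. grid_state m n B i) (partial_diagrams n i 0) (toric_perms {m + 1 - i..m} {m + 1..m + n}) \<and>
    (\<forall>B\<in>partial_diagrams n i 0. \<forall>c\<in>{1..n}. grid_state m n B i (m + c) = m + c \<longleftrightarrow> (\<forall>i'\<in>{1..i}. (i', c) \<in> B))"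
  using assms
proof (induction i)
  case 0
  have D: "partial_diagrams n 0 0 = {{}}" by (auto simp: partial_diagrams_def cauchon_cond_def)
  \<comment> \<open>With no rows read, the permutation never exceeds its argument and must be the
    identity.\<close>
  have "toric_perms {} {m + 1..m + n} = {id}"
    using permutes_natset_le by (fastforce simp: toric_perms_def permutes_id)
  moreover have "{m + 1 - 0..m} = {}" by simp
  ultimately have T: "toric_perms {m + 1 - 0..m} {m + 1..m + n} = {id}" by metis
  show ?case unfolding D T by (simp add: bij_betw_def id_def)
next
  case (Suc i)
  have D: "partial_diagrams n i n = partial_diagrams n (Suc i) 0"
  proof -
    have "{1..i} \<times> {1..n} \<union> {Suc i} \<times> {1..n} = {1..Suc i} \<times> {1..n} \<union> {Suc (Suc i)} \<times> {1..0}"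
      by auto
    then show ?thesis unfolding partial_diagrams_def by simp
  qed
  have A: "insert (m - i) {m + 1 - i..m} = {m + 1 - Suc i..m}" using Suc.prems by auto
  have Z: "row_perms (m - i) {m + 1 - i..m} {m + 1..m + n} (m + n) = toric_perms {m + 1 - Suc i..m} {m + 1..m + n}"
    unfolding A[symmetric] by (rule row_perms_end) auto
  have "bij_betw (\<lambda>B. row_state m B (Suc i) (grid_state m n B i) n) (partial_diagrams n i n)
        (row_perms (m - i) {m + 1 - i..m} {m + 1..m + n} (m + n)) \<and>
     (\<forall>B\<in>partial_diagrams n i n. row_inv m n i n B (row_state m B (Suc i) (grid_state m n B i) n))"
    by (rule row_bij) (use Suc in auto)
  then show ?case unfolding D Z by (auto simp: row_inv_def)
qed

lemma toric_perm_bij: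
  assumes "m \<ge> 1" "n \<ge> 1"
  shows "bij_betw (toric_perm m n) {B. cauchon m n B} (toric_perms {1..m} {m + 1..m + n})"
proof -
  have "partial_diagrams n m 0 = {B. cauchon m n B}"
    by (auto simp: partial_diagrams_def cauchon_def cauchon_cond_def is_diagram_def)
  moreover have "toric_perm m n = (\<lambda>B. grid_state m n B m)"
    using toric_perm_eq_grid_state[OF assms] by auto
  ultimately show ?thesis using grid_bij[of m m n] by simp
qed

section \<open>Words of alternating runs\<close>

lemma sum_Pow_card:
  fixes f :: "nat \<Rightarrow> nat"
  assumes "finite A"
  shows "(\<Sum>X\<in>Pow A. f (card X)) = (\<Sum>j\<le>card A. (card A choose j) * f j)"
proof -
  have "(\<Sum>X\<in>Pow A. f (card X)) = (\<Sum>j\<le>card A. \<Sum>X\<in>{X \<in> Pow A. card X = j}. f (card X))"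
    by (rule sum.group[symmetric]) (use assms in \<open>auto intro: card_mono\<close>)
  also have "\<dots> = (\<Sum>j\<le>card A. (card A choose j) * f j)"
  proof (rule sum.cong[OF refl])
    fix j
    have "(\<Sum>X\<in>{X \<in> Pow A. card X = j}. f (card X)) = (\<Sum>X\<in>{X. X \<subseteq> A \<and> card X = j}. f j)"
      by (rule sum.cong) auto
    then show "(\<Sum>X\<in>{X \<in> Pow A. card X = j}. f (card X)) = (card A choose j) * f j"
      by (simp add: n_subsets[OF assms])
  qed
  finally show ?thesis .
qed

text \<open>Later \<open>E\<close> is \<open>toric_step\<close> of the row labels; a word is then
  what follows the largest element in its cycle, and the empty word gives a fixed point.\<close>

definition words :: "('a \<Rightarrow> 'a \<Rightarrow> bool) \<Rightarrow> 'a set \<Rightarrow> 'a set \<Rightarrow> 'a list set" where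
  "words E A B = {ws. distinct ws \<and> set ws = A \<union> B \<and> successively E ws \<and> (ws \<noteq> [] \<longrightarrow> last ws \<in> A)}"

text \<open>Makes runs inside \<open>S\<close> correspond to subsets of \<open>S\<close>, so that
  runs are counted by choosing sets.\<close>

definition uniquely_sortable :: "('a \<Rightarrow> 'a \<Rightarrow> bool) \<Rightarrow> 'a set \<Rightarrow> bool" where
  "uniquely_sortable E S \<longleftrightarrow> (\<forall>X\<subseteq>S. \<exists>!xs. distinct xs \<and> set xs = X \<and> successively E xs)"

lemma finite_words: "finite A \<Longrightarrow> finite B \<Longrightarrow> finite (words E A B)"
  by (rule finite_subset[OF _ finite_subset_distinct[of "A \<union> B"]]) (auto simp: words_def)

text \<open>
  A nonempty word ending in \<open>A\<close> is a word ending in \<open>B\<close> followed by its last run,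
  which is determined by the underlying set \<open>X\<close>.
\<close>

lemma card_words_rec:
  assumes fin: "finite A" "finite B" and disj: "A \<inter> B = {}"
    and cross: "\<And>a b. a \<in> A \<Longrightarrow> b \<in> B \<Longrightarrow> E b a" and sortable: "uniquely_sortable E A"
  shows "card (words E A B) = of_bool (A = {} \<and> B = {}) + (\<Sum>X\<in>Pow A - {{}}. card (words E B (A - X)))"
proof -
  define srt where "srt X = (THE xs. distinct xs \<and> set xs = X \<and> successively E xs)" for X
  have srt: "distinct (srt X)" "set (srt X) = X" "successively E (srt X)" if "X \<subseteq> A" for X
    using theI'[of "\<lambda>xs. distinct xs \<and> set xs = X \<and> successively E xs"] sortable that
    unfolding srt_def uniquely_sortable_def by blast+
  have srt_eq: "xs = srt X" if "X \<subseteq> A" "distinct xs" "set xs = X" "successively E xs" for X xs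
    using srt[OF that(1)] that sortable unfolding uniquely_sortable_def by blast
  let ?S = "SIGMA X:Pow A - {{}}. words E B (A - X)"
  have bij: "bij_betw (\<lambda>(X, us). us @ srt X) ?S (words E A B - {[]})"
    unfolding bij_betw_def
  proof
    show "inj_on (\<lambda>(X, us). us @ srt X) ?S"
    proof (rule inj_onI)
      \<comment> \<open>If one prefix were longer, its excess \<open>zs\<close> would begin the
        other word's last run. The last letter of \<open>zs\<close> would then lie in both
        \<open>A\<close> and \<open>B\<close>.\<close>
      have main: "us = us'" if "us @ srt X = us' @ srt X'" "us' = us @ zs" "X \<subseteq> A" "X' \<subseteq> A"
        "us' \<in> words E B (A - X')" for us us' X X' zs
      proof (rule ccontr)
        assume "us \<noteq> us'"
        then have zs: "zs \<noteq> []" using that by auto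
        then have "last us' = last zs" "last us' \<in> B" using that by (auto simp: words_def)
        then have "last zs \<in> B" by simp
        moreover have "zs @ srt X' = srt X" using that by auto
        then have "last zs \<in> A" using zs srt(2)[OF that(3)] that(3) by (metis UnCI last_in_set set_append subsetD)
        ultimately show False using disj by auto
      qed
      fix z z' assume zz: "z \<in> ?S" "z' \<in> ?S" "(\<lambda>(X, us). us @ srt X) z = (\<lambda>(X, us). us @ srt X) z'"
      obtain X us X' us' where z: "z = (X, us)" "z' = (X', us')" by (cases z, cases z')
      have X: "X \<subseteq> A" "us \<in> words E B (A - X)" "X' \<subseteq> A" "us' \<in> words E B (A - X')"
        and e: "us @ srt X = us' @ srt X'" using zz unfolding z by auto
      have "us = us'"
        using e main[OF e _ X(1) X(3) X(4)] main[OF e[symmetric] _ X(3) X(1) X(2)]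
        unfolding append_eq_append_conv2 by metis
      then have "srt X = srt X'" using e by simp
      then have "X = X'" using srt(2) X by metis
      with \<open>us = us'\<close> show "z = z'" by (simp add: z)
    qed
    show "(\<lambda>(X, us). us @ srt X) ` ?S = words E A B - {[]}"
    proof (intro set_eqI iffI)
      fix ws assume "ws \<in> (\<lambda>(X, us). us @ srt X) ` ?S"
      then obtain X us where X: "X \<subseteq> A" "X \<noteq> {}" "us \<in> words E B (A - X)" "ws = us @ srt X" by auto
      have ne: "srt X \<noteq> []" using srt(2)[OF X(1)] X(2) by auto
      have "last ws \<in> A" using ne X srt(2)[OF X(1)] by (metis last_appendR last_in_set subsetD)
      moreover have "E (last us) (hd (srt X))" if "us \<noteq> []"
        using cross ne X srt(2)[OF X(1)] that hd_in_set[OF ne] by (auto simp: words_def)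
      ultimately show "ws \<in> words E A B - {[]}"
        using X srt[OF X(1)] ne disj by (auto simp: words_def successively_append_iff)
    next
      fix ws assume ws: "ws \<in> words E A B - {[]}"
      \<comment> \<open>The last run is the longest suffix with letters in \<open>A\<close>; a
        nonempty rest therefore ends in \<open>B\<close>.\<close>
      define vs where "vs = rev (takeWhile (\<lambda>x. x \<in> A) (rev ws))"
      define us where "us = rev (dropWhile (\<lambda>x. x \<in> A) (rev ws))"
      have wsuv: "ws = us @ vs"
        unfolding us_def vs_def by (metis rev_append rev_rev_ident takeWhile_dropWhile_id)
      have vA: "set vs \<subseteq> A" unfolding vs_def by (auto dest: set_takeWhileD)
      have vne: "vs \<noteq> []"
      proof -
        have "hd (rev ws) \<in> A" "rev ws \<noteq> []" using ws by (auto simp: words_def hd_rev)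
        then show ?thesis unfolding vs_def by (cases "rev ws") auto
      qed
      have uB: "last us \<in> B" if "us \<noteq> []"
      proof -
        have "last us \<notin> A" using that hd_dropWhile[of "\<lambda>x. x \<in> A" "rev ws"] unfolding us_def by (auto simp: last_rev)
        moreover have "last us \<in> A \<union> B" using ws that wsuv by (auto simp: words_def)
        ultimately show ?thesis by auto
      qed
      have d: "distinct us" "distinct vs" "set us \<inter> set vs = {}" "set us \<union> set vs = A \<union> B"
        "successively E us" "successively E vs"
        using ws unfolding words_def wsuv by (auto simp: successively_append_iff)
      have "vs = srt (set vs)" by (rule srt_eq) (use vA d in auto)
      moreover have "us \<in> words E B (A - set vs)" using d uB vA disj by (auto simp: words_def)
      moreover have "set vs \<in> Pow A - {{}}" using vA vne by auto
      ultimately show "ws \<in> (\<lambda>(X, us). us @ srt X) ` ?S"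
        using wsuv by (intro image_eqI[of _ _ "(set vs, us)"]) auto
    qed
  qed
  have "card (words E A B - {[]}) = (\<Sum>X\<in>Pow A - {{}}. card (words E B (A - X)))"
    using bij_betw_same_card[OF bij] fin by (subst (asm) card_SigmaI) (auto intro: finite_words)
  moreover have "[] \<in> words E A B \<longleftrightarrow> A = {} \<and> B = {}" by (auto simp: words_def)
  moreover have "card (words E A B) = of_bool ([] \<in> words E A B) + card (words E A B - {[]})"
    using card.remove[OF finite_words[OF fin, of E], of "[]"] by (cases "[] \<in> words E A B") auto
  ultimately show ?thesis by simp
qed

text \<open>Removing the last run exchanges the roles of the two sets, hence the swapped arguments.
  The exponential generating function satisfies
  \<open>W(x,y) = 1 + (exp x - 1) * W(y,x)\<close>.\<close>

function word_count :: "nat \<Rightarrow> nat \<Rightarrow> nat" where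
  "word_count a b = of_bool (a = 0 \<and> b = 0) + (\<Sum>j\<in>{1..a}. (a choose j) * word_count b (a - j))"
  by pat_completeness auto
termination
  by (relation "Wellfounded.measure (\<lambda>(a,b). a + b)") auto

declare word_count.simps [simp del]

lemma uniquely_sortable_subset: "uniquely_sortable E S \<Longrightarrow> T \<subseteq> S \<Longrightarrow> uniquely_sortable E T"
  unfolding uniquely_sortable_def
proof (intro allI impI)
  fix X assume *: "\<forall>X\<subseteq>S. \<exists>!xs. distinct xs \<and> set xs = X \<and> successively E xs" and "T \<subseteq> S" "X \<subseteq> T"
  then have "X \<subseteq> S" by blast
  then show "\<exists>!xs. distinct xs \<and> set xs = X \<and> successively E xs" using * by simp
qed

text \<open>The hypotheses are symmetric in \<open>A\<close> and \<open>B\<close>, so the induction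
  hypothesis applies to the remaining word with the roles exchanged.\<close>

lemma card_words:
  assumes "finite A" "finite B" "A \<inter> B = {}"
    and "\<And>a b. a \<in> A \<Longrightarrow> b \<in> B \<Longrightarrow> E b a \<and> E a b"
    and "uniquely_sortable E A" "uniquely_sortable E B"
  shows "card (words E A B) = word_count (card A) (card B)"
  using assms
proof (induction "card A + card B" arbitrary: A B rule: less_induct)
  case less
  have "card (words E B (A - X)) = word_count (card B) (card A - card X)" if "X \<in> Pow A - {{}}" for X
  proof -
    have X: "finite X" "X \<subseteq> A" "X \<noteq> {}" using that less.prems(1) by (auto intro: finite_subset)
    then have c: "card (A - X) = card A - card X" "card X > 0" "card X \<le> card A"
      using less.prems(1) by (auto simp: card_Diff_subset card_gt_0_iff card_mono)
    have "card (words E B (A - X)) = word_count (card B) (card (A - X))"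
      by (rule less.hyps)
         (use less.prems c in \<open>auto intro: uniquely_sortable_subset\<close>)
    then show ?thesis using c by simp
  qed
  \<comment> \<open>The factor \<open>of_bool (card X \<noteq> 0)\<close> lets the sum run over all
    of \<open>Pow A\<close>, where it can be grouped by size.\<close>
  then have "(\<Sum>X\<in>Pow A - {{}}. card (words E B (A - X))) =
      (\<Sum>X\<in>Pow A - {{}}. of_bool (card X \<noteq> 0) * word_count (card B) (card A - card X))"
    using less.prems(1) by (intro sum.cong) (auto simp: finite_subset card_eq_0_iff)
  also have "\<dots> = (\<Sum>X\<in>Pow A. of_bool (card X \<noteq> 0) * word_count (card B) (card A - card X))"
    by (rule sum.mono_neutral_left) (use less.prems(1) in auto)
  also have "\<dots> = (\<Sum>j\<le>card A. (card A choose j) * (of_bool (j \<noteq> 0) * word_count (card B) (card A - j)))"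
    by (rule sum_Pow_card[OF less.prems(1)])
  also have "\<dots> = (\<Sum>j\<in>{1..card A}. (card A choose j) * word_count (card B) (card A - j))"
    by (rule sum.mono_neutral_cong_right) auto
  finally show ?case
    using card_words_rec[of A B E] less.prems
    by (subst word_count.simps) simp
qed

text \<open>
  If all elements of \<open>A\<close> are smaller than all elements of \<open>B\<close>, a word for this relation is
  an alternation of increasing runs in \<open>A\<close> and decreasing runs in \<open>B\<close>.
\<close>

definition toric_step :: "nat set \<Rightarrow> nat \<Rightarrow> nat \<Rightarrow> bool" where
  "toric_step A i j \<longleftrightarrow> (if i \<in> A then i < j else j < i)"

lemma ex1_strict_sorted: "finite X \<Longrightarrow> \<exists>!xs. distinct xs \<and> set xs = X \<and> successively (<) (xs :: nat list)"
  unfolding successively_conv_sorted_wrt[OF transp_on_less]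
  by (rule ex1I[of _ "sorted_list_of_set X"]) (auto intro!: strict_sorted_equal)

text \<open>Inside \<open>A\<close> the relation is \<open><\<close> and outside it is
  \<open>>\<close>, so the unique run is the increasing or the decreasing listing. Reversal reduces
  the second case to the first.\<close>

lemma toric_step_sortable:
  assumes "finite S" "S \<subseteq> A \<or> S \<inter> A = {}"
  shows "uniquely_sortable (toric_step A) S"
  unfolding uniquely_sortable_def
proof (intro allI impI)
  fix X assume X: "X \<subseteq> S"
  then have fX: "finite X" using assms(1) by (rule finite_subset)
  show "\<exists>!xs. distinct xs \<and> set xs = X \<and> successively (toric_step A) xs"
  proof (cases "S \<subseteq> A")
    case True
    then have "successively (toric_step A) xs = successively (<) xs" if "set xs = X" for xs
      using X that by (intro successively_cong) (auto simp: toric_step_def)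
    then have "(distinct xs \<and> set xs = X \<and> successively (toric_step A) xs) =
        (distinct xs \<and> set xs = X \<and> successively (<) xs)" for xs by blast
    then show ?thesis using ex1_strict_sorted[OF fX] by presburger
  next
    case False
    then have "successively (toric_step A) xs = successively (\<lambda>x y. y < x) xs" if "set xs = X" for xs
      using X that assms(2) by (intro successively_cong) (auto simp: toric_step_def)
    then have eq: "(distinct xs \<and> set xs = X \<and> successively (toric_step A) xs) =
        (distinct (rev xs) \<and> set (rev xs) = X \<and> successively (<) (rev xs))" for xs by auto
    obtain ys where ys: "distinct ys \<and> set ys = X \<and> successively (<) ys"
      "\<And>zs. distinct zs \<and> set zs = X \<and> successively (<) zs \<Longrightarrow> zs = ys"
      using ex1_strict_sorted[OF fX] by blast
    show ?thesis unfolding eq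
    proof (rule ex1I[of _ "rev ys"])
      fix xs assume "distinct (rev xs) \<and> set (rev xs) = X \<and> successively (<) (rev xs)"
      then have "rev xs = ys" by (rule ys(2))
      then show "xs = rev ys" by auto
    qed (use ys(1) in simp)
  qed
qed

lemma card_toric_words:
  assumes "finite A" "finite B" "\<And>a b. a \<in> A \<Longrightarrow> b \<in> B \<Longrightarrow> a < b" "X \<subseteq> A" "Y \<subseteq> B"
  shows "card (words (toric_step A) X Y) = word_count (card X) (card Y)"
proof (rule card_words)
  have "A \<inter> B = {}" using assms(3) by fastforce
  then show "X \<inter> Y = {}" "uniquely_sortable (toric_step A) X" "uniquely_sortable (toric_step A) Y"
    using assms by (auto intro!: toric_step_sortable intro: finite_subset)
  show "toric_step A b a \<and> toric_step A a b" if "a \<in> X" "b \<in> Y" for a b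
    using that assms \<open>A \<inter> B = {}\<close> by (auto simp: toric_step_def)
qed (use assms in \<open>auto intro: finite_subset\<close>)

section \<open>Splitting off the cycle of the largest element\<close>

text \<open>\<open>num_odd_cycles\<close> over an arbitrary set, since removing a cycle need not
  leave an initial segment of labels.\<close>

definition odd_cycle_count :: "nat set \<Rightarrow> (nat \<Rightarrow> nat) \<Rightarrow> nat" where
  "odd_cycle_count S f = card {cycle_of f x | x. x \<in> S \<and> even (card (cycle_of f x))}"

lemma cycle_of_eq_orbit: "permutation f \<Longrightarrow> cycle_of f x = orbit f x"
  unfolding cycle_of_def by (rule orbit_altdef_permutation[symmetric])

lemma cycle_of_list_nth:
  assumes "distinct cs" "i < length cs"
  shows "cycle_of_list cs (cs ! i) = rotate1 cs ! i"
proof -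
  have "map (cycle_of_list cs) cs = rotate1 cs"
    using cyclic_rotation[OF assms(1), of 1] by simp
  then show ?thesis using assms(2) by (metis nth_map)
qed

section \<open>Joining a cycle to a permutation of a disjoint set\<close>

context
  fixes x :: nat and xs :: "nat list" and R :: "nat set" and p g :: "nat \<Rightarrow> nat"
  assumes dist: "distinct (x # xs)" and finR: "finite R" and p: "p permutes R"
    and disj: "set (x # xs) \<inter> R = {}"
  defines "g \<equiv> cycle_of_list (x # xs) \<circ> p"
begin

lemma cycle_comp_in: "y \<in> set (x # xs) \<Longrightarrow> g y = cycle_of_list (x # xs) y"
proof -
  assume "y \<in> set (x # xs)"
  then have "y \<notin> R" using disj by blast
  then show ?thesis using permutes_not_in[OF p] by (simp add: g_def)
qed

lemma cycle_comp_out: "y \<notin> set (x # xs) \<Longrightarrow> g y = p y"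
proof -
  assume y: "y \<notin> set (x # xs)"
  have "p y \<notin> set (x # xs)"
  proof (cases "y \<in> R")
    case True
    then have "p y \<in> R" using permutes_in_image[OF p] by simp
    then show ?thesis using disj by blast
  next
    case False
    then show ?thesis using y permutes_not_in[OF p] by simp
  qed
  then show ?thesis using id_outside_supp[of "p y" "x # xs"] by (simp add: g_def)
qed

lemma cycle_comp_permutes: "g permutes (set (x # xs) \<union> R)"
  unfolding g_def
  by (rule permutes_compose) (use p cycle_permutes[of "x # xs"] in \<open>auto intro: permutes_subset\<close>)

lemma cycle_comp_permutation: "permutation g"
  using cycle_comp_permutes finR permutation_permutes by blast

lemma cycle_comp_nth: "i < length (x # xs) \<Longrightarrow> g ((x # xs) ! i) = (xs @ [x]) ! i"
proof -
  assume i: "i < length (x # xs)"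
  then have "(x # xs) ! i \<in> set (x # xs)" by (rule nth_mem)
  then have "g ((x # xs) ! i) = cycle_of_list (x # xs) ((x # xs) ! i)" by (rule cycle_comp_in)
  then show ?thesis using cycle_of_list_nth[OF dist i] by simp
qed

lemma cycle_comp_funpow: "i < length (x # xs) \<Longrightarrow> (g ^^ i) x = (x # xs) ! i"
proof (induction i)
  case (Suc i)
  then have "(g ^^ Suc i) x = g ((x # xs) ! i)" by simp
  also have "\<dots> = (xs @ [x]) ! i" by (rule cycle_comp_nth) (use Suc in auto)
  finally show ?case using Suc.prems by (simp add: nth_append)
qed simp

text \<open>The iterates of \<open>g\<close> at \<open>x\<close> run through distinct entries and
  first return to \<open>x\<close> after the whole list. So the word of a cycle can be recovered
  from \<open>g\<close>.\<close>

lemma cycle_comp_support: "support g x = x # xs"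
proof -
  let ?l = "length (x # xs)"
  have "(g ^^ ?l) x = g ((g ^^ length xs) x)" by simp
  also have "\<dots> = (xs @ [x]) ! length xs" using cycle_comp_funpow[of "length xs"] cycle_comp_nth[of "length xs"] by simp
  finally have l: "(g ^^ ?l) x = x" by simp
  have "least_power g x = ?l"
    unfolding least_power_def
  proof (rule Least_equality)
    show "(g ^^ ?l) x = x \<and> 0 < ?l" using l by simp
    fix y assume y: "(g ^^ y) x = x \<and> 0 < y"
    show "?l \<le> y"
    proof (rule ccontr)
      assume "\<not> ?l \<le> y"
      then have yl: "y < ?l" by simp
      then have "(x # xs) ! y = (x # xs) ! 0" using cycle_comp_funpow[OF yl] y by simp
      then show False using y yl nth_eq_iff_index_eq[OF dist yl, of 0] by simp
    qed
  qed
  then have "support g x = map (\<lambda>i. (x # xs) ! i) [0..<?l]"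
    using cycle_comp_funpow by (simp del: upt_Suc)
  then show ?thesis by (simp only: map_nth)
qed

lemma orbit_cycle_comp_in:
  assumes "y \<in> set (x # xs)"
  shows "orbit g y = set (x # xs)"
proof -
  have "orbit g x = set (support g x)"
    unfolding support_set[OF cycle_comp_permutation] orbit_altdef_permutation[OF cycle_comp_permutation] by auto
  then have o: "orbit g x = set (x # xs)" by (simp only: cycle_comp_support)
  then show ?thesis
    using orbit_cyclic_eq3[OF cyclic_on_orbit'[OF cycle_comp_permutation], of y x] assms by simp
qed

lemma orbit_cycle_comp_out:
  assumes "y \<in> R"
  shows "orbit g y = orbit p y"
proof (rule orbit_cong0[OF assms])
  have eq: "g z = p z" if "z \<in> R" for z using that disj by (intro cycle_comp_out) blast
  then show "g \<in> R \<rightarrow> R" using permutes_in_image[OF p] by auto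
  show "\<And>z. z \<in> R \<Longrightarrow> g z = p z" by (rule eq)
qed

text \<open>The orbits of \<open>g\<close> are the new cycle and the orbits of \<open>p\<close> on
  \<open>R\<close>; the new cycle is none of the latter, as it is not contained in
  \<open>R\<close>.\<close>

lemma odd_cycle_count_cycle_comp:
  "odd_cycle_count (set (x # xs) \<union> R) g = odd_cycle_count R p + of_bool (even (length (x # xs)))"
proof -
  have pp: "permutation p" using p finR permutation_permutes by blast
  let ?C = "set (x # xs)"
  have cC: "card ?C = length (x # xs)" using dist by (rule distinct_card)
  let ?L = "{orbit g y | y. y \<in> ?C \<union> R \<and> even (card (orbit g y))}"
  let ?M = "{orbit p y | y. y \<in> R \<and> even (card (orbit p y))}"
  let ?N = "if even (length (x # xs)) then {?C} else {}"
  have "?L = ?M \<union> ?N"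
  proof (intro set_eqI iffI)
    fix z assume "z \<in> ?L"
    then obtain y where y: "z = orbit g y" "y \<in> ?C \<union> R" "even (card (orbit g y))" by blast
    show "z \<in> ?M \<union> ?N"
    proof (cases "y \<in> ?C")
      case True
      have e: "orbit g y = ?C" by (rule orbit_cycle_comp_in[OF True])
      have "even (length (x # xs))" using y(3) unfolding e cC .
      then have "?N = {?C}" by simp
      then show ?thesis using y(1) e by blast
    next
      case False
      then have yR: "y \<in> R" using y(2) by blast
      then have "z \<in> ?M" using y orbit_cycle_comp_out[OF yR] by auto
      then show ?thesis by blast
    qed
  next
    fix z assume "z \<in> ?M \<union> ?N"
    then show "z \<in> ?L"
    proof
      assume "z \<in> ?M"
      then obtain y where "z = orbit p y" "y \<in> R" "even (card (orbit p y))" by blast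
      then show ?thesis using orbit_cycle_comp_out by (intro CollectI exI[of _ y]) auto
    next
      assume "z \<in> ?N"
      then have z: "z = ?C" "even (length (x # xs))" by (auto split: if_splits)
      have "x \<in> ?C" by simp
      from z orbit_cycle_comp_in[OF this] cC show ?thesis
        by (intro CollectI exI[of _ x]) simp
    qed
  qed
  moreover have "?C \<notin> ?M"
  proof
    assume "?C \<in> ?M"
    then obtain y where y: "?C = orbit p y" "y \<in> R" by blast
    then have "?C \<subseteq> R" using permutes_orbit_subset[OF p] by metis
    then show False using disj by auto
  qed
  moreover have "finite ?M" using finR by simp
  ultimately have "card ?L = card ?M + of_bool (even (length (x # xs)))" by (simp del: list.set)
  then show ?thesis
    unfolding odd_cycle_count_def cycle_of_eq_orbit[OF cycle_comp_permutation] cycle_of_eq_orbit[OF pp] .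
qed

end

text \<open>Go round the cycle from its largest element \<open>b0\<close>. The step out of
  \<open>b0\<close> holds automatically, inner steps are strict because the entries are distinct,
  and the step back up to \<open>b0\<close> is allowed exactly from \<open>A\<close>.\<close>

lemma toric_cycle_iff:
  assumes AB: "\<forall>a\<in>A. \<forall>b\<in>B. a < b" and b0: "b0 \<in> B" "\<forall>b\<in>B. b \<le> b0"
    and ws: "distinct (b0 # ws)" "set ws \<subseteq> A \<union> B"
  shows "(\<forall>i<length (b0 # ws). let y = (b0 # ws) ! i; z = (ws @ [b0]) ! i in
            (y \<in> A \<longrightarrow> y \<le> z) \<and> (y \<in> B \<longrightarrow> z \<le> y)) \<longleftrightarrow>
      successively (toric_step A) ws \<and> (ws \<noteq> [] \<longrightarrow> last ws \<in> A)" (is "?L \<longleftrightarrow> ?R")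
proof -
  have dAB: "A \<inter> B = {}" using AB by fastforce
  have le: "z \<le> b0" if "z \<in> A \<union> B" for z using that AB b0 by (auto intro: less_imp_le)
  let ?ok = "\<lambda>y z. (y \<in> A \<longrightarrow> y \<le> z) \<and> (y \<in> B \<longrightarrow> z \<le> y)"
  have ok: "?ok y z \<longleftrightarrow> toric_step A y z" if "y \<in> A \<union> B" "y \<noteq> z" for y z
    using that dAB by (auto simp: toric_step_def)
  have nb: "b0 \<notin> A" using dAB b0 by blast
  have first: "?ok b0 ((ws @ [b0]) ! 0)"
  proof -
    have "(ws @ [b0]) ! 0 \<in> set (ws @ [b0])" by (rule nth_mem) simp
    then have "(ws @ [b0]) ! 0 \<le> b0" using le ws(2) b0 by auto
    then show ?thesis using nb by blast
  qed
  have mid: "?ok (ws ! i) (ws ! Suc i) \<longleftrightarrow> toric_step A (ws ! i) (ws ! Suc i)" if "Suc i < length ws" for i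
  proof (rule ok)
    have "ws ! i \<in> set ws" using that by (intro nth_mem) simp
    then show "ws ! i \<in> A \<union> B" using ws(2) by blast
    show "ws ! i \<noteq> ws ! Suc i" using ws(1) that by (simp add: nth_eq_iff_index_eq)
  qed
  have last: "?ok (last ws) b0 \<longleftrightarrow> last ws \<in> A" if "ws \<noteq> []"
  proof -
    have m: "last ws \<in> set ws" using that by simp
    then have "last ws \<in> A \<union> B" "last ws \<noteq> b0" using ws by auto
    then show ?thesis using le[of "last ws"] dAB by auto
  qed
  have L: "?L \<longleftrightarrow> (\<forall>i<length ws. ?ok (ws ! i) ((ws @ [b0]) ! Suc i))"
    unfolding Let_def length_Cons All_less_Suc2 nth_Cons_0 nth_Cons_Suc using first by blast
  show ?thesis
  proof (cases "ws = []")
    case True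
    then show ?thesis unfolding L by simp
  next
    case False
    define n where "n = length ws - 1"
    have n: "length ws = Suc n" using False by (simp add: n_def)
    have "(\<forall>i<length ws. ?ok (ws ! i) ((ws @ [b0]) ! Suc i)) \<longleftrightarrow>
       (\<forall>i<n. ?ok (ws ! i) ((ws @ [b0]) ! Suc i)) \<and> ?ok (ws ! n) ((ws @ [b0]) ! Suc n)"
      unfolding n less_Suc_eq by blast
    also have "(ws @ [b0]) ! Suc n = b0" using n by (simp add: nth_append)
    also have "ws ! n = last ws" using n False by (simp add: last_conv_nth)
    also have "(\<forall>i<n. ?ok (ws ! i) ((ws @ [b0]) ! Suc i)) \<longleftrightarrow> (\<forall>i<n. toric_step A (ws ! i) (ws ! Suc i))"
      using mid n by (simp add: nth_append)
    also have "\<dots> \<longleftrightarrow> successively (toric_step A) ws"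
      unfolding successively_conv_nth n by simp
    finally show ?thesis unfolding L using last[OF False] False by blast
  qed
qed


text \<open>\<open>support p x\<close> lists the cycle of \<open>x\<close>, and the second factor is
  \<open>p\<close> restricted to the complement of that cycle.\<close>

lemma permutes_cycle_decomp:
  assumes p: "p permutes S" and fin: "finite S" and x: "x \<in> S"
  obtains xs where "distinct (x # xs)" "set (x # xs) \<subseteq> S"
    "(\<lambda>y. if y \<in> S - set (x # xs) then p y else y) permutes (S - set (x # xs))"
    "p = cycle_of_list (x # xs) \<circ> (\<lambda>y. if y \<in> S - set (x # xs) then p y else y)"
proof -
  have pp: "permutation p" using p fin permutation_permutes by blast
  have "least_power p x > 0" by (rule least_power_of_permutation(2)[OF pp])
  then have x_tl: "support p x = x # tl (support p x)"
    by (cases "least_power p x") (simp_all add: upt_conv_Cons del: upt_Suc)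
  define xs where "xs = tl (support p x)"
  have xs: "support p x = x # xs" using x_tl unfolding xs_def .
  let ?r = "\<lambda>y. if y \<in> S - set (x # xs) then p y else y"
  have d: "distinct (x # xs)" using cycle_of_permutation[OF pp, of x] unfolding xs .
  have sub: "set (x # xs) \<subseteq> S"
  proof -
    have "(p ^^ i) x \<in> S" for i
      using permutes_in_image[OF permutes_funpow[OF p]] x by simp
    then show ?thesis using support_set[OF pp, of x] unfolding xs by auto
  qed
  have r: "?r permutes (S - set (x # xs))"
    using semidecomposition[OF p fin, of x] unfolding xs .
  have "p y = cycle_of_list (x # xs) (?r y)" for y
  proof (cases "y \<in> set (x # xs)")
    case True
    then show ?thesis using cycle_restrict[OF pp, of y x] unfolding xs by auto
  next
    case False
    have "?r y \<notin> set (x # xs)"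
    proof (cases "y \<in> S")
      case True
      then have "?r y \<in> S - set (x # xs)" using permutes_in_image[OF r, of y] False by blast
      then show ?thesis by blast
    next
      case F: False
      then have "?r y = y" by simp
      then show ?thesis using False by metis
    qed
    then have "cycle_of_list (x # xs) (?r y) = ?r y" by (rule id_outside_supp)
    moreover have "?r y = p y" using False permutes_not_in[OF p, of y] by auto
    ultimately show ?thesis by simp
  qed
  then have "p = cycle_of_list (x # xs) \<circ> ?r" by (auto simp del: list.set)
  from that[OF d sub r this] show thesis .
qed

text \<open>\<open>X\<close> and \<open>Y\<close> are determined by the word, but keeping them makes
  the cardinality a sum over pairs of subsets.\<close>

definition cycle_splits :: "nat set \<Rightarrow> nat set \<Rightarrow> nat \<Rightarrow> ((nat set \<times> nat set) \<times> nat list \<times> (nat \<Rightarrow> nat)) set" where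
  "cycle_splits A B b0 = (SIGMA XY : Pow A \<times> Pow (B - {b0}).
     words (toric_step A) (fst XY) (snd XY) \<times> toric_perms (A - fst XY) (B - {b0} - snd XY))"

definition cycle_join :: "nat \<Rightarrow> (nat set \<times> nat set) \<times> nat list \<times> (nat \<Rightarrow> nat) \<Rightarrow> nat \<Rightarrow> nat" where
  "cycle_join b0 z = cycle_of_list (b0 # fst (snd z)) \<circ> snd (snd z)"

lemma cycle_splitsD:
  assumes fin: "finite A" "finite B" and AB: "\<forall>a\<in>A. \<forall>b\<in>B. a < b" and b0: "b0 \<in> B"
    and z: "((X, Y), ws, p) \<in> cycle_splits A B b0"
  shows "X \<subseteq> A" "Y \<subseteq> B" "b0 \<notin> Y" "set (b0 # ws) = insert b0 (X \<union> Y)" "distinct (b0 # ws)"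
    "p permutes (A \<union> B - set (b0 # ws))" "X = set ws \<inter> A" "Y = set ws \<inter> B"
    "(A - X) \<union> (B - {b0} - Y) = A \<union> B - set (b0 # ws)"
    "length (b0 # ws) = Suc (card X + card Y)"
proof -
  have dAB: "A \<inter> B = {}" using AB by fastforce
  show XY: "X \<subseteq> A" "Y \<subseteq> B" "b0 \<notin> Y" using z by (auto simp: cycle_splits_def)
  have w: "distinct ws" "set ws = X \<union> Y" using z by (auto simp: cycle_splits_def words_def)
  then show s: "set (b0 # ws) = insert b0 (X \<union> Y)" by simp
  show d: "distinct (b0 # ws)" using w XY dAB b0 by auto
  show "X = set ws \<inter> A" "Y = set ws \<inter> B" using w XY dAB by auto
  show eq: "(A - X) \<union> (B - {b0} - Y) = A \<union> B - set (b0 # ws)" using s XY dAB b0 by auto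
  show "p permutes (A \<union> B - set (b0 # ws))"
    using z unfolding eq[symmetric] by (auto simp: cycle_splits_def toric_perms_def)
  have "card (X \<union> Y) = card X + card Y"
    by (rule card_Un_disjoint) (use fin XY dAB in \<open>auto intro: finite_subset\<close>)
  then show "length (b0 # ws) = Suc (card X + card Y)"
    using distinct_card[OF w(1)] w(2) by simp
qed

text \<open>The support at \<open>b0\<close> returns the word, and cancelling the cycle returns the
  rest. The toric condition can be checked separately on the cycle, by
  \<open>toric_cycle_iff\<close>, and on the rest.\<close>

lemma cycle_join_bij:
  assumes fin: "finite A" "finite B" and AB: "\<forall>a\<in>A. \<forall>b\<in>B. a < b"
    and b0: "b0 \<in> B" "\<forall>b\<in>B. b \<le> b0"
  shows "bij_betw (cycle_join b0) (cycle_splits A B b0) (toric_perms A B)"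
  unfolding bij_betw_def
proof
  have dAB: "A \<inter> B = {}" using AB by fastforce
  note D = cycle_splitsD[OF fin AB b0(1)]
  show "inj_on (cycle_join b0) (cycle_splits A B b0)"
  proof (rule inj_onI)
    fix z z' assume zz: "z \<in> cycle_splits A B b0" "z' \<in> cycle_splits A B b0"
      and e: "cycle_join b0 z = cycle_join b0 z'"
    obtain X Y ws p where z: "z = ((X, Y), ws, p)" by (cases z) auto
    obtain X' Y' ws' p' where z': "z' = ((X', Y'), ws', p')" by (cases z') auto
    note d = D[OF zz(1)[unfolded z]] and d' = D[OF zz(2)[unfolded z']]
    have e': "cycle_of_list (b0 # ws) \<circ> p = cycle_of_list (b0 # ws') \<circ> p'"
      using e by (simp add: cycle_join_def z z')
    have fR: "finite (A \<union> B - set (b0 # ws))" "finite (A \<union> B - set (b0 # ws'))" using fin by auto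
    have "support (cycle_of_list (b0 # ws) \<circ> p) b0 = b0 # ws"
      by (rule cycle_comp_support[OF d(5) fR(1) d(6)]) auto
    moreover have "support (cycle_of_list (b0 # ws') \<circ> p') b0 = b0 # ws'"
      by (rule cycle_comp_support[OF d'(5) fR(2) d'(6)]) auto
    ultimately have ws: "ws = ws'" using e' by simp
    have "inj (cycle_of_list (b0 # ws))" using cycle_permutes permutes_inj by blast
    then have "p = p'" using e' unfolding ws[symmetric] by (auto simp: fun_eq_iff dest: injD)
    then show "z = z'" using ws d(7,8) d'(7,8) by (simp add: z z')
  qed
  show "cycle_join b0 ` cycle_splits A B b0 = toric_perms A B"
  proof (intro set_eqI iffI)
    fix q assume "q \<in> cycle_join b0 ` cycle_splits A B b0"
    then obtain X Y ws p where z: "((X, Y), ws, p) \<in> cycle_splits A B b0"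
      and q: "q = cycle_of_list (b0 # ws) \<circ> p" by (auto simp: cycle_join_def)
    note d = D[OF z]
    have fR: "finite (A \<union> B - set (b0 # ws))" using fin by auto
    have dj: "set (b0 # ws) \<inter> (A \<union> B - set (b0 # ws)) = {}" by blast
    have p: "p permutes (A \<union> B - set (b0 # ws))" by (rule d(6))
    have dist: "distinct (b0 # ws)" by (rule d(5))
    have sub: "set (b0 # ws) \<subseteq> A \<union> B" using d(1,2,4) b0 by auto
    have "q permutes (set (b0 # ws) \<union> (A \<union> B - set (b0 # ws)))"
      unfolding q by (rule cycle_comp_permutes[OF dist fR p dj])
    then have qp: "q permutes (A \<union> B)" using sub by (simp add: Un_absorb1 del: list.set)
    have "successively (toric_step A) ws \<and> (ws \<noteq> [] \<longrightarrow> last ws \<in> A)"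
      using z by (auto simp: cycle_splits_def words_def)
    then have ok: "\<forall>i<length (b0 # ws). let y = (b0 # ws) ! i; z = (ws @ [b0]) ! i in
            (y \<in> A \<longrightarrow> y \<le> z) \<and> (y \<in> B \<longrightarrow> z \<le> y)"
      using toric_cycle_iff[OF AB b0 dist] sub by auto
    have "(y \<in> A \<longrightarrow> y \<le> q y) \<and> (y \<in> B \<longrightarrow> q y \<le> y)" for y
    proof (cases "y \<in> set (b0 # ws)")
      case True
      then obtain i where i: "i < length (b0 # ws)" "y = (b0 # ws) ! i" by (metis in_set_conv_nth)
      have "q y = (ws @ [b0]) ! i"
        unfolding i(2) q by (rule cycle_comp_nth[OF dist fR p dj i(1)])
      then show ?thesis using ok i unfolding Let_def by metis
    next
      case False
      then have "q y = p y" unfolding q by (rule cycle_comp_out[OF dist fR p dj])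
      moreover have "p \<in> toric_perms (A - X) (B - {b0} - Y)" using z by (auto simp: cycle_splits_def)
      moreover have "y \<noteq> b0" "y \<notin> X" "y \<notin> Y" using False d(4) by auto
      ultimately show ?thesis by (auto simp: toric_perms_def)
    qed
    then show "q \<in> toric_perms A B" using qp by (auto simp: toric_perms_def)
  next
    fix q assume q: "q \<in> toric_perms A B"
    then have qp: "q permutes (A \<union> B)" and qA: "\<And>a. a \<in> A \<Longrightarrow> a \<le> q a" and qB: "\<And>b. b \<in> B \<Longrightarrow> q b \<le> b"
      by (auto simp: toric_perms_def)
    have fAB: "finite (A \<union> B)" using fin by simp
    have "b0 \<in> A \<union> B" using b0 by simp
    from permutes_cycle_decomp[OF qp fAB this] obtain ws where
      dist: "distinct (b0 # ws)" and sub: "set (b0 # ws) \<subseteq> A \<union> B"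
      and r: "(\<lambda>y. if y \<in> A \<union> B - set (b0 # ws) then q y else y) permutes (A \<union> B - set (b0 # ws))"
      and qe: "q = cycle_of_list (b0 # ws) \<circ> (\<lambda>y. if y \<in> A \<union> B - set (b0 # ws) then q y else y)"
      by blast
    define p where "p = (\<lambda>y. if y \<in> A \<union> B - set (b0 # ws) then q y else y)"
    have pp: "p permutes (A \<union> B - set (b0 # ws))" and q_eq: "q = cycle_of_list (b0 # ws) \<circ> p"
      using r qe unfolding p_def by blast+
    have fR: "finite (A \<union> B - set (b0 # ws))" using fin by auto
    have dj: "set (b0 # ws) \<inter> (A \<union> B - set (b0 # ws)) = {}" by blast
    define X Y where "X = set ws \<inter> A" and "Y = set ws \<inter> B"
    have bnot: "b0 \<notin> set ws" "b0 \<notin> A" using dist dAB b0 by auto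
    have setws: "set ws = X \<union> Y" using sub by (auto simp: X_def Y_def)
    have eq: "(A - X) \<union> (B - {b0} - Y) = A \<union> B - set (b0 # ws)"
      using bnot by (auto simp: X_def Y_def)
    have "p \<in> toric_perms (A - X) (B - {b0} - Y)"
      unfolding toric_perms_def eq using pp qA qB by (auto simp: p_def)
    moreover have "ws \<in> words (toric_step A) X Y"
    proof -
      have "let y = (b0 # ws) ! i; z = (ws @ [b0]) ! i in
            (y \<in> A \<longrightarrow> y \<le> z) \<and> (y \<in> B \<longrightarrow> z \<le> y)" if i: "i < length (b0 # ws)" for i
      proof -
        have "q ((b0 # ws) ! i) = (ws @ [b0]) ! i"
          unfolding q_eq by (rule cycle_comp_nth[OF dist fR pp dj i])
        then show ?thesis using qA qB unfolding Let_def by metis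
      qed
      then have "successively (toric_step A) ws \<and> (ws \<noteq> [] \<longrightarrow> last ws \<in> A)"
        using toric_cycle_iff[OF AB b0 dist] sub by auto
      then show ?thesis using dist setws unfolding words_def X_def by (auto dest: last_in_set)
    qed
    moreover have "X \<in> Pow A" "Y \<in> Pow (B - {b0})" using bnot by (auto simp: X_def Y_def)
    ultimately have "((X, Y), ws, p) \<in> cycle_splits A B b0" by (auto simp: cycle_splits_def)
    moreover have "q = cycle_join b0 ((X, Y), ws, p)" using q_eq by (simp add: cycle_join_def)
    ultimately show "q \<in> cycle_join b0 ` cycle_splits A B b0" by blast
  qed
qed


text \<open>Here \<open>a\<close> and \<open>b\<close> count the other elements in the cycle of the
  largest element. Its length is \<open>a + b + 1\<close>, so it uses up one unit of
  \<open>d\<close> exactly when \<open>a + b\<close> is odd.\<close>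

fun toric_count :: "nat \<Rightarrow> nat \<Rightarrow> nat \<Rightarrow> nat" where
  "toric_count m 0 d = of_bool (d = 0)"
| "toric_count m (Suc n) d = (\<Sum>a\<le>m. \<Sum>b\<le>n. (m choose a) * (n choose b) * word_count a b *
     (if even (a + b) then toric_count (m - a) (n - b) d
      else if d = 0 then 0 else toric_count (m - a) (n - b) (d - 1)))"

lemma finite_toric_perms: "finite A \<Longrightarrow> finite B \<Longrightarrow> finite (toric_perms A B)"
  by (rule finite_subset[OF _ finite_permutations[of "A \<union> B"]]) (auto simp: toric_perms_def)

lemma odd_cycle_count_id: "odd_cycle_count S id = 0"
  by (simp add: odd_cycle_count_def cycle_of_def)

lemma odd_cycle_count_cycle_join:
  assumes fin: "finite A" "finite B" and AB: "\<forall>a\<in>A. \<forall>b\<in>B. a < b" and b0: "b0 \<in> B"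
    and z: "((X, Y), ws, p) \<in> cycle_splits A B b0"
  shows "odd_cycle_count (A \<union> B) (cycle_join b0 ((X, Y), ws, p)) =
    odd_cycle_count ((A - X) \<union> (B - {b0} - Y)) p + of_bool (odd (card X + card Y))"
proof -
  note d = cycle_splitsD[OF fin AB b0 z]
  have fR: "finite (A \<union> B - set (b0 # ws))" using fin by auto
  have dj: "set (b0 # ws) \<inter> (A \<union> B - set (b0 # ws)) = {}" by blast
  have un: "set (b0 # ws) \<union> (A \<union> B - set (b0 # ws)) = A \<union> B" using d(1,2,4) b0 by auto
  show ?thesis
    using odd_cycle_count_cycle_comp[OF d(5) fR d(6) dj]
    unfolding un d(9,10) by (simp add: cycle_join_def)
qed

lemma card_toric_perms:
  assumes "finite A" "finite B" "\<forall>a\<in>A. \<forall>b\<in>B. a < b"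
  shows "card {p \<in> toric_perms A B. odd_cycle_count (A \<union> B) p = d} = toric_count (card A) (card B) d"
  using assms
proof (induction "card B" arbitrary: A B d rule: less_induct)
  case less
  note fin = less.prems(1,2) and AB = less.prems(3)
  show ?case
  proof (cases "B = {}")
    case True
    \<comment> \<open>A permutation that never falls below its argument is the identity, which has
      no odd cycles.\<close>
    have "toric_perms A {} = {id}"
      using permutes_natset_ge by (fastforce simp: toric_perms_def permutes_id)
    then have "{p \<in> toric_perms A B. odd_cycle_count (A \<union> B) p = d} = (if d = 0 then {id} else {})"
      using True odd_cycle_count_id by auto
    then show ?thesis using True by simp
  next
    case False
    define b0 where "b0 = Max B"
    have b0: "b0 \<in> B" "\<forall>b\<in>B. b \<le> b0" using False fin by (auto simp: b0_def)
    define B' where "B' = B - {b0}"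
    define n where "n = card B'"
    have fB': "finite B'" using fin by (simp add: B'_def)
    have cB: "card B = Suc n" using card_Suc_Diff1[OF fin(2) b0(1)] by (simp add: n_def B'_def)
    let ?good = "\<lambda>X Y. {p \<in> toric_perms (A - X) (B' - Y).
       odd_cycle_count ((A - X) \<union> (B' - Y)) p + of_bool (odd (card X + card Y)) = d}"
    let ?S = "SIGMA XY : Pow A \<times> Pow B'. words (toric_step A) (fst XY) (snd XY) \<times> ?good (fst XY) (snd XY)"
    let ?Z = "{z \<in> cycle_splits A B b0. odd_cycle_count (A \<union> B) (cycle_join b0 z) = d}"
    \<comment> \<open>The condition on \<open>d\<close> concerns only the remaining permutation once
      \<open>X\<close> and \<open>Y\<close> are chosen, so each fibre is a product of two
      sets.\<close>
    have ZS: "?Z = ?S"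
    proof (intro set_eqI)
      fix z :: "(nat set \<times> nat set) \<times> nat list \<times> (nat \<Rightarrow> nat)"
      obtain X Y ws p where z: "z = ((X, Y), ws, p)" by (cases z) auto
      have mem: "z \<in> cycle_splits A B b0 \<longleftrightarrow> X \<subseteq> A \<and> Y \<subseteq> B' \<and> ws \<in> words (toric_step A) X Y \<and>
          p \<in> toric_perms (A - X) (B' - Y)"
        by (auto simp: z cycle_splits_def B'_def)
      show "z \<in> ?Z \<longleftrightarrow> z \<in> ?S"
      proof (cases "z \<in> cycle_splits A B b0")
        case True
        then have "odd_cycle_count (A \<union> B) (cycle_join b0 z) =
            odd_cycle_count ((A - X) \<union> (B' - Y)) p + of_bool (odd (card X + card Y))"
          unfolding z B'_def by (rule odd_cycle_count_cycle_join[OF fin AB b0(1)])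
        then show ?thesis using True mem by (simp add: z)
      next
        case False
        then show ?thesis using mem by (auto simp: z)
      qed
    qed
    have good: "card (?good X Y) = (if even (card X + card Y) then toric_count (card A - card X) (n - card Y) d
        else if d = 0 then 0 else toric_count (card A - card X) (n - card Y) (d - 1))"
      if XY: "X \<subseteq> A" "Y \<subseteq> B'" for X Y
    proof -
      have c: "card (A - X) = card A - card X" "card (B' - Y) = n - card Y"
        using XY fin fB' by (simp_all add: card_Diff_subset finite_subset n_def)
      have IH: "card {p \<in> toric_perms (A - X) (B' - Y). odd_cycle_count ((A - X) \<union> (B' - Y)) p = e} =
          toric_count (card A - card X) (n - card Y) e" for e
        unfolding c[symmetric]
        by (rule less.hyps) (use fin fB' AB cB c in \<open>auto simp: B'_def\<close>)
      show ?thesis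
      proof (cases "even (card X + card Y)")
        case True
        then show ?thesis using IH by simp
      next
        case False
        then have "?good X Y = (if d = 0 then {} else
            {p \<in> toric_perms (A - X) (B' - Y). odd_cycle_count ((A - X) \<union> (B' - Y)) p = d - 1})"
          by (cases d) auto
        then show ?thesis using IH False by simp
      qed
    qed
    have bij: "bij_betw (cycle_join b0) (cycle_splits A B b0) (toric_perms A B)"
      by (rule cycle_join_bij[OF fin AB b0])
    have "{p \<in> toric_perms A B. odd_cycle_count (A \<union> B) p = d} = cycle_join b0 ` ?Z"
      using bij_betw_imp_surj_on[OF bij] by auto
    moreover have "inj_on (cycle_join b0) ?Z"
      using bij_betw_imp_inj_on[OF bij] by (rule inj_on_subset) auto
    ultimately have "card {p \<in> toric_perms A B. odd_cycle_count (A \<union> B) p = d} = card ?S"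
      unfolding ZS by (simp add: card_image)
    also have "card ?S = (\<Sum>XY\<in>Pow A \<times> Pow B'. card (words (toric_step A) (fst XY) (snd XY) \<times> ?good (fst XY) (snd XY)))"
      by (rule card_SigmaI)
         (use fin fB' in \<open>auto intro!: finite_cartesian_product finite_words finite_toric_perms intro: finite_subset\<close>)
    also have "\<dots> = (\<Sum>X\<in>Pow A. \<Sum>Y\<in>Pow B'. word_count (card X) (card Y) *
        (if even (card X + card Y) then toric_count (card A - card X) (n - card Y) d
        else if d = 0 then 0 else toric_count (card A - card X) (n - card Y) (d - 1)))"
      unfolding sum.cartesian_product
    proof (rule sum.cong[OF refl])
      fix XY assume "XY \<in> Pow A \<times> Pow B'"
      then obtain X Y where XY: "XY = (X, Y)" "X \<subseteq> A" "Y \<subseteq> B'" by auto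
      have "card (words (toric_step A) X Y) = word_count (card X) (card Y)"
        by (rule card_toric_words[OF fin _ XY(2)]) (use AB XY(3) in \<open>auto simp: B'_def\<close>)
      then show "card (words (toric_step A) (fst XY) (snd XY) \<times> ?good (fst XY) (snd XY)) =
         (case XY of (X, Y) \<Rightarrow> word_count (card X) (card Y) *
        (if even (card X + card Y) then toric_count (card A - card X) (n - card Y) d
        else if d = 0 then 0 else toric_count (card A - card X) (n - card Y) (d - 1)))"
        using good[OF XY(2,3)] by (simp add: XY(1) card_cartesian_product)
    qed
    \<comment> \<open>The summand depends only on the sizes of \<open>X\<close> and
      \<open>Y\<close>, which yields the binomial coefficients.\<close>
    also have "\<dots> = (\<Sum>X\<in>Pow A. \<Sum>b\<le>n. (n choose b) * (word_count (card X) b *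
        (if even (card X + b) then toric_count (card A - card X) (n - b) d
        else if d = 0 then 0 else toric_count (card A - card X) (n - b) (d - 1))))"
      unfolding n_def by (intro sum.cong refl sum_Pow_card fB')
    also have "\<dots> = (\<Sum>a\<le>card A. (card A choose a) * (\<Sum>b\<le>n. (n choose b) * (word_count a b *
        (if even (a + b) then toric_count (card A - a) (n - b) d
        else if d = 0 then 0 else toric_count (card A - a) (n - b) (d - 1)))))"
      by (rule sum_Pow_card[OF fin(1)])
    also have "\<dots> = toric_count (card A) (card B) d"
      unfolding cB toric_count.simps sum_distrib_left by (simp only: mult.assoc)
    finally show ?thesis .
  qed
qed

section \<open>Taylor coefficients\<close>

text \<open>The product of exponential generating functions, on the level of coefficients.\<close>

definition binconv :: "(nat \<Rightarrow> real) \<Rightarrow> (nat \<Rightarrow> real) \<Rightarrow> nat \<Rightarrow> real" where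
  "binconv a b k = (\<Sum>j\<le>k. real (k choose j) * a j * b (k - j))"

text \<open>The Leibniz rule for coefficient sequences; it rests on Pascal's rule.\<close>

lemma binconv_Suc:
  "binconv a b (Suc k) = binconv (\<lambda>i. a (Suc i)) b k + binconv a (\<lambda>i. b (Suc i)) k"
proof -
  have "binconv a b (Suc k) = a 0 * b (Suc k) +
      (\<Sum>j\<le>k. real (k choose j) * a (Suc j) * b (k - j)) +
      (\<Sum>j\<le>k. real (k choose Suc j) * a (Suc j) * b (k - j))"
    unfolding binconv_def
    by (subst sum.atMost_Suc_shift) (simp add: sum.distrib [symmetric] algebra_simps)
  also have "a 0 * b (Suc k) + (\<Sum>j\<le>k. real (k choose j) * a (Suc j) * b (k - j)) +
      (\<Sum>j\<le>k. real (k choose Suc j) * a (Suc j) * b (k - j)) =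
      (\<Sum>j\<le>k. real (k choose j) * a (Suc j) * b (k - j)) +
      (\<Sum>j\<le>Suc k. real (k choose j) * a j * b (Suc k - j))"
    by (subst sum.atMost_Suc_shift) simp
  also have "(\<Sum>j\<le>Suc k. real (k choose j) * a j * b (Suc k - j)) =
      (\<Sum>j\<le>k. real (k choose j) * a j * b (Suc (k - j)))"
    by (simp add: Suc_diff_le)
  finally show ?thesis by (simp add: binconv_def)
qed

text \<open>
  \<open>jet n f a\<close>: near \<open>0\<close> the function \<open>f\<close> is \<open>n\<close> times differentiable, and its
  derivatives at \<open>0\<close> up to order \<open>n\<close> are \<open>a 0, \<dots>, a n\<close>.
\<close>

primrec jet :: "nat \<Rightarrow> (real \<Rightarrow> real) \<Rightarrow> (nat \<Rightarrow> real) \<Rightarrow> bool" where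
  "jet 0 f a \<longleftrightarrow> f 0 = a 0"
| "jet (Suc n) f a \<longleftrightarrow> f 0 = a 0 \<and>
     (\<exists>f'. (\<forall>\<^sub>F x in nhds 0. (f has_real_derivative f' x) (at x)) \<and> jet n f' (\<lambda>k. a (Suc k)))"

lemma jet_cong_coeff: "jet n f a \<Longrightarrow> (\<And>k. k \<le> n \<Longrightarrow> a k = b k) \<Longrightarrow> jet n f b"
proof (induction n arbitrary: f a b)
  case (Suc n)
  then obtain f' where "\<forall>\<^sub>F x in nhds 0. (f has_real_derivative f' x) (at x)" "jet n f' (\<lambda>k. a (Suc k))"
    by auto
  moreover from this(2) have "jet n f' (\<lambda>k. b (Suc k))"
    by (rule Suc.IH) (use Suc.prems(2) in auto)
  ultimately show ?case using Suc.prems by auto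
qed auto

lemma jet_SucD: "jet (Suc n) f a \<Longrightarrow> jet n f a"
proof (induction n arbitrary: f a)
  case (Suc n)
  then obtain f' where "\<forall>\<^sub>F x in nhds 0. (f has_real_derivative f' x) (at x)"
      "jet (Suc n) f' (\<lambda>k. a (Suc k))" "f 0 = a 0"
    by (subst (asm) jet.simps) blast
  with Suc.IH[OF this(2)] show ?case by (subst jet.simps) blast
qed auto

lemma jet_0: "jet n f a \<Longrightarrow> f 0 = a 0"
  by (cases n) auto

text \<open>\<open>deriv f\<close> agrees with \<open>f'\<close> on a whole neighbourhood of 0, so
  their higher derivatives at 0 agree too.\<close>

lemma jet_deriv: "jet n f a \<Longrightarrow> k \<le> n \<Longrightarrow> (deriv ^^ k) f 0 = a k"
proof (induction n arbitrary: f a k)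
  case (Suc n)
  show ?case
  proof (cases k)
    case 0
    then show ?thesis using Suc.prems by auto
  next
    case (Suc l)
    obtain f' where f': "\<forall>\<^sub>F x in nhds 0. (f has_real_derivative f' x) (at x)" "jet n f' (\<lambda>k. a (Suc k))"
      using Suc.prems by auto
    have "\<forall>\<^sub>F x in nhds 0. deriv f x = f' x"
      using f'(1) by eventually_elim (rule DERIV_imp_deriv)
    then have "(deriv ^^ l) (deriv f) 0 = (deriv ^^ l) f' 0"
      by (intro higher_deriv_cong_ev) auto
    also have "\<dots> = a (Suc l)"
      using Suc.IH[OF f'(2), of l] Suc.prems Suc by auto
    finally show ?thesis using Suc by (simp add: funpow_Suc_right del: funpow.simps)
  qed
qed auto

lemma jet_unique: "jet n f a \<Longrightarrow> jet n f b \<Longrightarrow> k \<le> n \<Longrightarrow> a k = b k"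
  using jet_deriv by metis

lemma jet_cong_ev:
  assumes "jet n f a" "\<forall>\<^sub>F x in nhds 0. f x = g x"
  shows "jet n g a"
proof (cases n)
  case 0
  then show ?thesis using assms eventually_nhds_x_imp_x by fastforce
next
  case (Suc l)
  obtain f' where f': "\<forall>\<^sub>F x in nhds 0. (f has_real_derivative f' x) (at x)" "jet l f' (\<lambda>k. a (Suc k))"
    using assms Suc by auto
  \<comment> \<open>Transferring a derivative at \<open>x\<close> needs agreement near
    \<open>x\<close>, not only at \<open>x\<close>.\<close>
  have "\<forall>\<^sub>F x in nhds 0. \<forall>\<^sub>F y in nhds x. f y = g y"
    using assms(2) by (subst eventually_eventually)
  with f'(1) have "\<forall>\<^sub>F x in nhds 0. (g has_real_derivative f' x) (at x)"
    by eventually_elim (metis DERIV_cong_ev)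
  moreover have "f 0 = g 0" using assms(2) eventually_nhds_x_imp_x by fastforce
  ultimately show ?thesis using f' assms(1) Suc by auto
qed

lemma jet_add: "jet n f a \<Longrightarrow> jet n g b \<Longrightarrow> jet n (\<lambda>x. f x + g x) (\<lambda>k. a k + b k)"
proof (induction n arbitrary: f a g b)
  case (Suc n)
  obtain f' where f': "\<forall>\<^sub>F x in nhds 0. (f has_real_derivative f' x) (at x)" "jet n f' (\<lambda>k. a (Suc k))"
    using Suc.prems by auto
  obtain g' where g': "\<forall>\<^sub>F x in nhds 0. (g has_real_derivative g' x) (at x)" "jet n g' (\<lambda>k. b (Suc k))"
    using Suc.prems by auto
  have "\<forall>\<^sub>F x in nhds 0. ((\<lambda>x. f x + g x) has_real_derivative f' x + g' x) (at x)"
    using f'(1) g'(1) by eventually_elim (rule DERIV_add)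
  then show ?case using Suc.IH[OF f'(2) g'(2)] Suc.prems by auto
qed auto

lemma jet_const: "jet n (\<lambda>_. c) (\<lambda>k. if k = 0 then c else 0)"
proof -
  have "jet n (\<lambda>_. 0) (\<lambda>_. 0)" for n
    by (induction n) (auto intro!: exI[of _ "\<lambda>_. 0"])
  then show ?thesis
    by (cases n) (auto intro!: exI[of _ "\<lambda>_. 0"])
qed

lemma jet_exp: "jet n exp (\<lambda>_. 1)"
  by (induction n) (auto intro!: exI[of _ exp])

lemma jet_mult: "jet n f a \<Longrightarrow> jet n g b \<Longrightarrow> jet n (\<lambda>x. f x * g x) (binconv a b)"
proof (induction n arbitrary: f a g b)
  case 0
  then show ?case by (simp add: binconv_def)
next
  case (Suc n)
  obtain f' where f': "\<forall>\<^sub>F x in nhds 0. (f has_real_derivative f' x) (at x)" "jet n f' (\<lambda>k. a (Suc k))"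
    using Suc.prems by auto
  obtain g' where g': "\<forall>\<^sub>F x in nhds 0. (g has_real_derivative g' x) (at x)" "jet n g' (\<lambda>k. b (Suc k))"
    using Suc.prems by auto
  have "\<forall>\<^sub>F x in nhds 0. ((\<lambda>x. f x * g x) has_real_derivative f' x * g x + f x * g' x) (at x)"
    using f'(1) g'(1)
    by eventually_elim (auto intro!: derivative_eq_intros)
  moreover have "jet n (\<lambda>x. f' x * g x + f x * g' x) (\<lambda>k. binconv a b (Suc k))"
    unfolding binconv_Suc
    by (rule jet_add[OF Suc.IH[OF f'(2) jet_SucD[OF Suc.prems(2)]] Suc.IH[OF jet_SucD[OF Suc.prems(1)] g'(2)]])
  ultimately show ?case using Suc.prems by (auto simp: binconv_def)
qed

lemma binconv_const: "binconv (\<lambda>k. if k = 0 then c else 0) b = (\<lambda>k. c * b k)"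
proof
  fix k
  have "binconv (\<lambda>k. if k = 0 then c else 0) b k = (\<Sum>j\<in>{0}. real (k choose j) * c * b (k - j))"
    unfolding binconv_def by (intro sum.mono_neutral_cong_right) auto
  then show "binconv (\<lambda>k. if k = 0 then c else 0) b k = c * b k" by simp
qed

lemma jet_cmult: "jet n f a \<Longrightarrow> jet n (\<lambda>x. c * f x) (\<lambda>k. c * a k)"
  using jet_mult[OF jet_const[of n c], of f a] by (simp add: binconv_const)

lemma jet_sum: "(\<And>i. i \<in> I \<Longrightarrow> jet n (f i) (a i)) \<Longrightarrow> jet n (\<lambda>x. \<Sum>i\<in>I. f i x) (\<lambda>k. \<Sum>i\<in>I. a i k)"
proof (induction I rule: infinite_finite_induct)
  case (insert i I)
  have "jet n (\<lambda>x. f i x + (\<Sum>i\<in>I. f i x)) (\<lambda>k. a i k + (\<Sum>i\<in>I. a i k))"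
    by (intro jet_add insert.IH insert.prems) auto
  then show ?case using insert.hyps by simp
qed (use jet_const[of n 0] in auto)

lemma jet_reflect: "jet n f a \<Longrightarrow> jet n (\<lambda>x. f (- x)) (\<lambda>k. (-1) ^ k * a k)"
proof (induction n arbitrary: f a)
  case (Suc n)
  obtain f' where f': "\<forall>\<^sub>F x in nhds 0. (f has_real_derivative f' x) (at x)" "jet n f' (\<lambda>k. a (Suc k))"
    using Suc.prems by auto
  have "filterlim (\<lambda>x::real. - x) (nhds 0) (nhds 0)"
    using tendsto_minus[OF filterlim_ident[of "nhds (0::real)"]] by simp
  then have "\<forall>\<^sub>F x in nhds 0. (f has_real_derivative f' (- x)) (at (- x))"
    using f'(1) unfolding filterlim_iff by blast
  then have "\<forall>\<^sub>F x in nhds 0. ((\<lambda>x. f (- x)) has_real_derivative (-1) * f' (- x)) (at x)"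
    by eventually_elim (use DERIV_mirror in auto)
  then show ?case
    using jet_cmult[OF Suc.IH[OF f'(2)], of "-1"] Suc.prems by (auto simp del: mult_minus1)
qed auto

text \<open>Passes from a possibly different coefficient sequence for each order to a single
  sequence for all orders.\<close>

lemma jet_all_derivs:
  assumes "\<And>n. \<exists>a. jet n f a"
  shows "jet n f (\<lambda>k. (deriv ^^ k) f 0)"
proof -
  obtain a where a: "jet n f a" using assms by blast
  show ?thesis
    by (rule jet_cong_coeff[OF a]) (simp add: jet_deriv[OF a])
qed


text \<open>
  This is the derivative in \<open>y\<close> of \<open>- ln (exp (- y) + exp (- x) - 1)\<close>. The Riccati equation
  \<open>R' = R\<^sup>2 - R\<close> shows that it is smooth in \<open>y\<close>, and the linear equation
  \<open>R = 1 + (exp x - 1) * (1 + (exp y - 1) * R)\<close> is the recursion for words.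
\<close>

definition cycR :: "real \<Rightarrow> real \<Rightarrow> real" where
  "cycR x y = exp (- y) / (exp (- y) + exp (- x) - 1)"

text \<open>The Taylor coefficients of \<open>cycR x\<close> in \<open>y\<close> as functions of
  \<open>x\<close>; the recursion is the linear equation read coefficientwise.\<close>

fun rho :: "real \<Rightarrow> nat \<Rightarrow> real" where
  "rho x b = of_bool (b = 0) + (exp x - 1) *
     (of_bool (b = 0) + (\<Sum>j\<in>{1..b}. real (b choose j) * rho x (b - j)))"

declare rho.simps [simp del]

text \<open>At \<open>y = 0\<close> the two expressions are \<open>exp (- x)\<close> and
  \<open>exp x\<close>, so every real \<open>x\<close> is covered and only \<open>y\<close> has to
  be small.\<close>

lemma eventually_cycR_denom_pos:
  "\<forall>\<^sub>F y in nhds 0. exp (- y) + exp (- x) - 1 > (0::real)"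
  "\<forall>\<^sub>F y in nhds 0. exp y + exp x - 1 > (0::real)"
proof -
  have "((\<lambda>y. exp (- y) + exp (- x) - 1) \<longlongrightarrow> exp (- 0) + exp (- x) - 1) (nhds (0::real))"
    by (intro tendsto_intros filterlim_ident)
  then show "\<forall>\<^sub>F y in nhds 0. exp (- y) + exp (- x) - 1 > (0::real)"
    by (rule order_tendstoD(1)) simp
  have "((\<lambda>y. exp y + exp x - 1) \<longlongrightarrow> exp 0 + exp x - 1) (nhds (0::real))"
    by (intro tendsto_intros filterlim_ident)
  then show "\<forall>\<^sub>F y in nhds 0. exp y + exp x - 1 > (0::real)"
    by (rule order_tendstoD(1)) simp
qed

lemma cycR_deriv:
  "\<forall>\<^sub>F y in nhds 0. (cycR x has_real_derivative cycR x y * cycR x y + (-1) * cycR x y) (at y)"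
  using eventually_cycR_denom_pos(1)[of x]
proof eventually_elim
  case (elim y)
  let ?D = "exp (- y) + exp (- x) - 1"
  have "(cycR x has_real_derivative ((- exp (- y)) * ?D - exp (- y) * (- exp (- y))) / (?D * ?D)) (at y)"
    unfolding cycR_def [abs_def] using elim
    by (intro DERIV_divide) (auto intro!: derivative_eq_intros)
  also have "((- exp (- y)) * ?D - exp (- y) * (- exp (- y))) / (?D * ?D) =
      cycR x y * cycR x y + (-1) * cycR x y"
    unfolding cycR_def using elim by (simp add: diff_divide_distrib)
  finally show ?case .
qed

text \<open>The derivative is a polynomial in \<open>cycR\<close> itself, so differentiability of
  one order gives the next.\<close>

lemma jet_cycR_ex: "\<exists>a. jet n (cycR x) a"
proof (induction n)
  case 0
  show ?case by (auto intro: exI[of _ "\<lambda>_. cycR x 0"])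
next
  case (Suc n)
  then obtain a where a: "jet n (cycR x) a" by blast
  have "jet n (\<lambda>y. cycR x y * cycR x y + (-1) * cycR x y) (\<lambda>k. binconv a a k + (-1) * a k)"
    by (intro jet_add jet_mult jet_cmult a)
  then have "jet (Suc n) (cycR x) (case_nat (cycR x 0) (\<lambda>k. binconv a a k + (-1) * a k))"
    using cycR_deriv[of x] by (auto simp del: mult_minus1)
  then show ?case by blast
qed

lemma binconv_exp_minus_1:
  "binconv (\<lambda>k. 1 + (if k = 0 then - 1 else 0)) a b = (\<Sum>j\<in>{1..b}. real (b choose j) * a (b - j))"
  unfolding binconv_def by (rule sum.mono_neutral_cong_right) auto

lemma jet_exp_minus_1: "jet n (\<lambda>x. exp x - 1) (\<lambda>k. 1 + (if k = 0 then - 1 else 0))"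
  using jet_add[OF jet_exp jet_const[of n "-1"]] by simp

lemma cycR_linear:
  "\<forall>\<^sub>F y in nhds 0. 1 + (exp x - 1) * (1 + (exp y - 1) * cycR x y) = cycR x y"
  using eventually_cycR_denom_pos(1)[of x]
proof eventually_elim
  case (elim y)
  have e: "exp (- x) * exp x = 1" "exp (- y) * exp y = 1"
    by (simp_all flip: exp_add)
  \<comment> \<open>In these variables the claim is a polynomial identity modulo
    \<open>u * u' = 1\<close> and \<open>v * v' = 1\<close>.\<close>
  define u v u' v' where uv: "u = exp x" "v = exp y" "u' = exp (-x)" "v' = exp (-y)"
  have "(1 + (u - 1)) * (v' + u' - 1) + (u - 1) * (v - 1) * v' = v'"
    using e unfolding uv[symmetric] by algebra
  then have "1 + (u - 1) * (1 + (v - 1) * (v' / (v' + u' - 1))) = v' / (v' + u' - 1)"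
    using elim unfolding uv[symmetric] by (simp add: field_simps)
  then show ?case by (simp add: uv cycR_def)
qed

text \<open>With smoothness known, both sides of the linear equation are jets of one function. By
  uniqueness the derivatives satisfy the recursion that defines \<open>rho\<close>.\<close>

lemma jet_cycR: "jet n (cycR x) (rho x)"
proof -
  define D where "D k = (deriv ^^ k) (cycR x) 0" for k
  have D: "jet n (cycR x) D" for n
    using jet_all_derivs[OF jet_cycR_ex] unfolding D_def by blast
  let ?c = "\<lambda>k. (if k = 0 then 1 else 0) + (exp x - 1) *
     ((if k = 0 then 1 else 0) + binconv (\<lambda>k. 1 + (if k = 0 then - 1 else 0)) D k)"
  have "jet n (\<lambda>y. 1 + (exp x - 1) * (1 + (exp y - 1) * cycR x y)) ?c" for n
    by (intro jet_add jet_cmult jet_const jet_mult D jet_exp_minus_1)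
  then have c: "jet n (cycR x) ?c" for n
    using jet_cong_ev[OF _ cycR_linear] by blast
  have eq: "D k = ?c k" for k
    by (rule jet_unique[OF D[of k] c[of k]]) simp
  have "D k = rho x k" for k
  proof (induction k rule: less_induct)
    case (less k)
    then have "(\<Sum>j\<in>{1..k}. real (k choose j) * D (k - j)) = (\<Sum>j\<in>{1..k}. real (k choose j) * rho x (k - j))"
      by (intro sum.cong) auto
    then show ?case
      by (subst rho.simps) (subst eq, simp add: binconv_exp_minus_1)
  qed
  then have "D = rho x" by blast
  with D show ?thesis by simp
qed

text \<open>One step of \<open>rho\<close> is two steps of \<open>word_count\<close>: the bracket
  \<open>?t\<close> generates the swapped counts \<open>word_count b a\<close>, and multiplying by
  \<open>exp x - 1\<close> performs the second step.\<close>

lemma jet_rho: "jet n (\<lambda>x. rho x b) (\<lambda>a. real (word_count a b))"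
proof (induction b rule: less_induct)
  case (less b)
  let ?t = "\<lambda>x. (if b = 0 then 1 else 0) + (\<Sum>j\<in>{1..b}. real (b choose j) * rho x (b - j))"
  have "jet n ?t (\<lambda>a. (if a = 0 then (if b = 0 then 1 else 0) else 0) +
      (\<Sum>j\<in>{1..b}. real (b choose j) * real (word_count a (b - j))))"
    by (intro jet_add jet_const jet_sum jet_cmult less.IH) auto
  also have "(\<lambda>a. (if a = 0 then (if b = 0 then 1 else 0) else 0) +
      (\<Sum>j\<in>{1..b}. real (b choose j) * real (word_count a (b - j)))) = (\<lambda>a. real (word_count b a))"
    by (subst (2) word_count.simps) (auto simp: of_bool_def)
  finally have t: "jet n ?t (\<lambda>a. real (word_count b a))" .
  have "jet n (\<lambda>x. (if b = 0 then 1 else 0) + (exp x - 1) * ?t x)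
     (\<lambda>a. (if a = 0 then (if b = 0 then 1 else 0) else 0) +
       binconv (\<lambda>k. 1 + (if k = 0 then - 1 else 0)) (\<lambda>a. real (word_count b a)) a)"
    by (intro jet_add jet_const jet_mult jet_exp_minus_1 t)
  moreover have "(\<lambda>x. (if b = 0 then 1 else 0) + (exp x - 1) * ?t x) = (\<lambda>x. rho x b)"
    by (subst (2) rho.simps) (auto simp: of_bool_def)
  moreover have "(\<lambda>a. (if a = 0 then (if b = 0 then 1 else 0) else 0) +
       binconv (\<lambda>k. 1 + (if k = 0 then - 1 else 0)) (\<lambda>a. real (word_count b a)) a) =
       (\<lambda>a. real (word_count a b))"
    unfolding binconv_exp_minus_1 by (subst (2) word_count.simps) (auto simp: of_bool_def)
  ultimately show ?case by simp
qed

section \<open>Separating cycles by parity and matching the coefficients\<close>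

definition odd_rho :: "real \<Rightarrow> nat \<Rightarrow> real" where
  "odd_rho x b = 1/2 * (rho x b + (-1) ^ b * rho (- x) b)"

text \<open>The names refer to the cycle length \<open>a + b + 1\<close>: \<open>odd_rho\<close>
  keeps the terms with \<open>a + b\<close> even, \<open>even_rho\<close> those with
  \<open>a + b\<close> odd. The reflected term comes from \<open>cycR (- x) (- y)\<close>.\<close>

definition even_rho :: "real \<Rightarrow> nat \<Rightarrow> real" where
  "even_rho x b = 1/2 * (rho x b + (- 1) * ((-1) ^ b * rho (- x) b))"

lemma jet_odd_rho: "jet n (\<lambda>x. odd_rho x b) (\<lambda>a. if even (a + b) then real (word_count a b) else 0)"
proof -
  have "jet n (\<lambda>x. odd_rho x b) (\<lambda>a. 1/2 * (real (word_count a b) + (-1) ^ b * ((-1) ^ a * real (word_count a b))))"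
    unfolding odd_rho_def by (intro jet_cmult jet_add jet_rho jet_reflect[OF jet_rho])
  then show ?thesis by (rule jet_cong_coeff) (auto simp: minus_one_power_iff)
qed

lemma jet_even_rho: "jet n (\<lambda>x. even_rho x b) (\<lambda>a. if even (a + b) then 0 else real (word_count a b))"
proof -
  have "jet n (\<lambda>x. even_rho x b) (\<lambda>a. 1/2 * (real (word_count a b) + (-1) * ((-1) ^ b * ((-1) ^ a * real (word_count a b)))))"
    unfolding even_rho_def by (intro jet_cmult jet_add jet_rho jet_reflect[OF jet_rho])
  then show ?thesis by (rule jet_cong_coeff) (auto simp: minus_one_power_iff)
qed

text \<open>The Taylor coefficients in \<open>y\<close> of the \<open>t ^ d\<close> part of
  \<open>genC\<close>. The start is \<open>genC x 0 t = exp x\<close>, free of \<open>t\<close>; the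
  recursion is its logarithmic derivative in \<open>y\<close>, whose \<open>t\<close>-part is
  \<open>even_rho\<close>.\<close>

fun phi :: "real \<Rightarrow> nat \<Rightarrow> nat \<Rightarrow> real" where
  "phi x 0 d = of_bool (d = 0) * exp x"
| "phi x (Suc n) d = (\<Sum>b\<le>n. real (n choose b) * odd_rho x b * phi x (n - b) d) +
     of_bool (d > 0) * (\<Sum>b\<le>n. real (n choose b) * even_rho x b * phi x (n - b) (d - 1))"

text \<open>Each product in the recursion becomes a binomial convolution in \<open>x\<close>, which
  supplies the sum over \<open>a\<close> in \<open>toric_count\<close>.\<close>

lemma jet_phi: "jet k (\<lambda>x. phi x n d) (\<lambda>m. real (toric_count m n d))"
proof (induction n arbitrary: d rule: less_induct)
  case (less n)
  show ?case
  proof (cases n)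
    case 0
    have "jet k (\<lambda>x. of_bool (d = 0) * exp x) (\<lambda>m. of_bool (d = 0) * 1)"
      by (intro jet_cmult jet_exp)
    then show ?thesis using 0 by simp
  next
    case (Suc l)
    let ?o = "\<lambda>m. \<Sum>b\<le>l. real (l choose b) * binconv
      (\<lambda>a. if even (a + b) then real (word_count a b) else 0) (\<lambda>m. real (toric_count m (l - b) d)) m"
    let ?e = "\<lambda>m. \<Sum>b\<le>l. real (l choose b) * binconv
      (\<lambda>a. if even (a + b) then 0 else real (word_count a b)) (\<lambda>m. real (toric_count m (l - b) (d - 1))) m"
    have "jet k (\<lambda>x. (\<Sum>b\<le>l. real (l choose b) * (odd_rho x b * phi x (l - b) d)) +
       of_bool (d > 0) * (\<Sum>b\<le>l. real (l choose b) * (even_rho x b * phi x (l - b) (d - 1))))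
       (\<lambda>m. ?o m + of_bool (d > 0) * ?e m)"
      by (intro jet_add jet_cmult jet_sum jet_mult jet_odd_rho jet_even_rho less.IH)
         (use Suc in auto)
    moreover have "?o m + of_bool (d > 0) * ?e m = real (toric_count m n d)" for m
    proof -
      have "?o m + of_bool (d > 0) * ?e m = (\<Sum>b\<le>l. \<Sum>a\<le>m. real (m choose a) * real (l choose b) *
         real (word_count a b) * (if even (a + b) then real (toric_count (m - a) (l - b) d)
         else if d = 0 then 0 else real (toric_count (m - a) (l - b) (d - 1))))"
        unfolding binconv_def sum_distrib_left sum.distrib [symmetric]
        by (intro sum.cong refl) auto
      also have "\<dots> = real (toric_count m n d)"
        unfolding Suc toric_count.simps of_nat_sum
        by (subst sum.swap) (intro sum.cong refl, auto)
      finally show ?thesis .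
    qed
    ultimately show ?thesis using Suc by (simp add: mult.assoc)
  qed
qed

text \<open>The coefficient of \<open>t ^ d\<close> in \<open>genC x y t\<close>.\<close>

definition coeffF :: "nat \<Rightarrow> real \<Rightarrow> real \<Rightarrow> real" where
  "coeffF d x y = exp ((ln (exp y + exp x - 1) - ln (exp (-y) + exp (-x) - 1)) / 2) *
     (- (ln (exp y + exp x - 1) + ln (exp (-y) + exp (-x) - 1)) / 2) ^ d / fact d"

text \<open>\<open>genC\<close> is \<open>S * exp (t * G)\<close> near 0, with \<open>t ^ d\<close>
  coefficient \<open>S * G ^ d / fact d\<close>. The two logarithms have derivatives
  \<open>- cycR x y\<close> and \<open>cycR (- x) (- y)\<close>; differentiating
  \<open>G ^ d / fact d\<close> produces the term for \<open>d - 1\<close>.\<close>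

lemma coeffF_deriv:
  "\<forall>\<^sub>F y in nhds 0. (coeffF d x has_real_derivative
     1/2 * (cycR x y + cycR (-x) (-y)) * coeffF d x y +
     of_bool (d > 0) * (1/2 * (cycR x y + (-1) * cycR (-x) (-y)) * coeffF (d - 1) x y)) (at y)"
  using eventually_cycR_denom_pos(1)[of x] eventually_cycR_denom_pos(2)[of x]
proof eventually_elim
  case (elim y)
  define lp where "lp = (\<lambda>y. ln (exp (-y) + exp (-x) - 1))"
  define lq where "lq = (\<lambda>y. ln (exp y + exp x - 1))"
  define S where "S = (\<lambda>y. exp ((lq y - lp y) / 2))"
  define G where "G = (\<lambda>y. - (lq y + lp y) / 2)"
  have P: "(lp has_real_derivative - cycR x y) (at y)"
    unfolding cycR_def lp_def using elim by (auto intro!: derivative_eq_intros)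
  have Q: "(lq has_real_derivative cycR (-x) (-y)) (at y)"
    unfolding cycR_def lq_def using elim by (auto intro!: derivative_eq_intros)
  have S: "(S has_real_derivative S y * (1/2 * (cycR x y + cycR (-x) (-y)))) (at y)"
    unfolding S_def by (auto intro!: derivative_eq_intros P Q simp: field_simps)
  have G: "(G has_real_derivative 1/2 * (cycR x y + (-1) * cycR (-x) (-y))) (at y)"
    unfolding G_def by (auto intro!: derivative_eq_intros P Q simp: field_simps)
  have F: "coeffF d x = (\<lambda>y. S y * G y ^ d / fact d)" for d
    by (simp add: coeffF_def S_def G_def lp_def lq_def fun_eq_iff)
  show ?case
  proof (cases d)
    case 0
    then show ?thesis using S unfolding F by (simp add: mult.commute)
  next
    case (Suc e)
    let ?s = "1/2 * (cycR x y + cycR (-x) (-y))" and ?g = "1/2 * (cycR x y + (-1) * cycR (-x) (-y))"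
    have "((\<lambda>y. S y * G y ^ d / fact d) has_real_derivative
       (S y * ?s * G y ^ d + S y * (real d * G y ^ e * ?g)) / fact d) (at y)"
      using DERIV_cdivide[OF DERIV_mult[OF S DERIV_power[OF G, of d]], of "fact d"]
      by (simp only: Suc diff_Suc_Suc diff_zero mult_ac)
    also have "(S y * ?s * G y ^ d + S y * (real d * G y ^ e * ?g)) / fact d =
       ?s * (S y * G y ^ d / fact d) + of_bool (d > 0) * (?g * (S y * G y ^ (d - 1) / fact (d - 1)))"
    proof -
      have "real d / fact d = 1 / fact e" unfolding Suc by (simp del: of_nat_Suc)
      moreover have "S y * (real d * G y ^ e * ?g) / fact d = real d / fact d * (?g * (S y * G y ^ e))"
        by (simp add: mult_ac)
      ultimately have *: "S y * (real d * G y ^ e * ?g) / fact d = ?g * (S y * G y ^ e / fact e)"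
        by simp
      have "S y * ?s * G y ^ d / fact d = ?s * (S y * G y ^ d / fact d)"
        by (simp only: mult_ac times_divide_eq_right)
      with * show ?thesis
        by (simp only: add_divide_distrib) (simp add: Suc)
    qed
    finally show ?thesis unfolding F .
  qed
qed

lemma jet_coeffF: "jet n (coeffF d x) (\<lambda>k. phi x k d)"
proof (induction n arbitrary: d)
  case 0
  \<comment> \<open>At \<open>y = 0\<close> the logarithms are \<open>x\<close> and
    \<open>- x\<close>; their sum vanishes, so only \<open>d = 0\<close> survives, with value
    \<open>exp x\<close>.\<close>
  show ?case by (simp add: coeffF_def)
next
  case (Suc n)
  have R: "jet n (cycR x) (rho x)" "jet n (\<lambda>y. cycR (- x) (- y)) (\<lambda>k. (-1) ^ k * rho (- x) k)"
    by (intro jet_cycR jet_reflect)+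
  have "jet n (\<lambda>y. 1/2 * (cycR x y + cycR (-x) (-y)) * coeffF d x y +
     of_bool (d > 0) * (1/2 * (cycR x y + (-1) * cycR (-x) (-y)) * coeffF (d - 1) x y))
     (\<lambda>k. binconv (odd_rho x) (\<lambda>k. phi x k d) k + of_bool (d > 0) * binconv (even_rho x) (\<lambda>k. phi x k (d - 1)) k)"
    unfolding odd_rho_def [abs_def] even_rho_def [abs_def]
    by (intro jet_add jet_cmult jet_mult Suc.IH R)
  moreover have "(\<lambda>k. binconv (odd_rho x) (\<lambda>k. phi x k d) k + of_bool (d > 0) * binconv (even_rho x) (\<lambda>k. phi x k (d - 1)) k)
     = (\<lambda>k. phi x (Suc k) d)"
    by (simp add: binconv_def fun_eq_iff)
  ultimately show ?case
    using coeffF_deriv[where d=d and x=x] jet_0[OF Suc.IH, of d] by auto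
qed

text \<open>As a function of \<open>t\<close>, \<open>genC\<close> is a constant times
  \<open>exp (t * g)\<close>, so each derivative contributes a factor \<open>g\<close>.\<close>

lemma genC_t_coeff:
  assumes "exp (-y) + exp (-x) - 1 > 0" "exp x + exp y - 1 > 0"
  shows "(deriv ^^ d) (\<lambda>t. genC x y t) 0 / fact d = coeffF d x y"
proof -
  define p where "p = ln (exp (-y) + exp (-x) - 1)"
  define q where "q = ln (exp x + exp y - 1)"
  define g where "g = - (q + p) / 2"
  have C: "genC x y = (\<lambda>t. exp ((q - p) / 2) * exp (t * g))"
    using assms unfolding genC_def powr_def p_def[symmetric] q_def[symmetric]
    by (auto simp: fun_eq_iff g_def field_simps simp flip: exp_add)
  have "(deriv ^^ d) (genC x y) = (\<lambda>t. exp ((q - p) / 2) * g ^ d * exp (t * g))"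
  proof (induction d)
    case (Suc d)
    have "((\<lambda>t. exp ((q - p) / 2) * g ^ d * exp (t * g)) has_real_derivative
       exp ((q - p) / 2) * g ^ Suc d * exp (t * g)) (at t)" for t
      by (rule derivative_eq_intros refl)+ simp
    then show ?case by (auto simp: Suc fun_eq_iff intro!: DERIV_imp_deriv)
  qed (simp add: C)
  then show ?thesis
    by (simp add: coeffF_def g_def p_def q_def add.commute)
qed

lemma coeffC_eq: "coeffC m n d = real (toric_count m n d)"
proof -
  \<comment> \<open>This holds for every real \<open>x\<close>, so the functions of \<open>x\<close>
    coincide before the outer derivatives are taken.\<close>
  have "(deriv ^^ n) (\<lambda>y. (deriv ^^ d) (\<lambda>t. genC x y t) 0 / fact d) 0 = phi x n d" for x
  proof -
    have "\<forall>\<^sub>F y in nhds 0. (deriv ^^ d) (\<lambda>t. genC x y t) 0 / fact d = coeffF d x y"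
      using eventually_cycR_denom_pos(1)[of x] eventually_cycR_denom_pos(2)[of x]
      by eventually_elim (rule genC_t_coeff, auto simp: add.commute)
    then have "(deriv ^^ n) (\<lambda>y. (deriv ^^ d) (\<lambda>t. genC x y t) 0 / fact d) 0 = (deriv ^^ n) (coeffF d x) 0"
      by (intro higher_deriv_cong_ev) auto
    also have "\<dots> = phi x n d" by (rule jet_deriv[OF jet_coeffF[of n]]) simp
    finally show ?thesis .
  qed
  then have "coeffC m n d = (deriv ^^ m) (\<lambda>x. phi x n d) 0"
    unfolding coeffC_def by simp
  also have "\<dots> = real (toric_count m n d)"
    by (rule jet_deriv[OF jet_phi[of m]]) simp
  finally show ?thesis .
qed

theorem theorem5p2:
  fixes m n d :: nat
  assumes "m \<ge> 1" and "n \<ge> 1"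
  shows "real (h m n d) = coeffC m n d"
proof -
  let ?A = "{1..m}" and ?B = "{m + 1..m + n}"
  have AB: "?A \<union> ?B = {1..m + n}" by auto
  have bij: "bij_betw (toric_perm m n) {B. cauchon m n B} (toric_perms ?A ?B)"
    by (rule toric_perm_bij[OF assms])
  \<comment> \<open>The bijection carries diagrams with \<open>d\<close> odd cycles onto toric
    permutations with \<open>d\<close> odd cycles.\<close>
  have "{p \<in> toric_perms ?A ?B. odd_cycle_count (?A \<union> ?B) p = d} =
      toric_perm m n ` {B. cauchon m n B \<and> num_odd_cycles (m + n) (toric_perm m n B) = d}"
    unfolding AB bij_betw_imp_surj_on[OF bij, symmetric] odd_cycle_count_def num_odd_cycles_def by auto
  moreover have "inj_on (toric_perm m n) {B. cauchon m n B \<and> num_odd_cycles (m + n) (toric_perm m n B) = d}"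
    using bij_betw_imp_inj_on[OF bij] by (rule inj_on_subset) auto
  ultimately have "h m n d = card {p \<in> toric_perms ?A ?B. odd_cycle_count (?A \<union> ?B) p = d}"
    by (simp only: h_def card_image)
  also have "\<dots> = toric_count (card ?A) (card ?B) d"
    by (rule card_toric_perms) auto
  finally show ?thesis by (simp add: coeffC_eq)
qed

end
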